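(* There is a universal constant $C$ such that the following holds. Let $n$ and $k$ be positive integers with $k\le n$, and let $F$ and $G$ be local statistics of degree $k$ on $S_n$, with local components $f_0,\ldots,f_{n-k}$ and $g_0,\ldots,g_{n-k}$ respectively. Suppose that the absolute values of the local components of $F$ and $G$ are uniformly bounded by $1$, that is, $|f_i(\pi)|\le 1$ and $|g_i(\pi)|\le 1$ for all $0\le i\le n-k$ and all $\pi\in S_n$. Let $\pi$ be chosen uniformly at random from $S_n$, let $$W := F(\pi)+G(\pi^{-1}),$$ and let $s^2 := \mathrm{Var}(W)$, where $s>0$. Then the Wasserstein distance between $(W-\mathbb{E}(W))/s$ and the standard normal distribution is at most $$C\left(n^{1/2}s^{-2}+n s^{-3}\right)k^3.$$
   Context: $S_n$ is the group of all permutations of $\{1,\ldots,n\}$, and $\pi^{-1}$ is the inverse permutation of $\pi$. A real-valued function $F$ on $S_n$ is called a local statistic of degree $k$ if it can be expressed as $$F(\pi)=\sum_{i=0}^{n-k} f_i(\pi),$$ where, for each $i$, the real-valued quantity $f_i(\pi)$ depends only on the relative ordering of $\pi(i+1),\ldots,\pi(i+k)$ (i.e. $f_i(\pi)=f_i(\pi')$ whenever, for all $1\le a,b\le k$, $\pi(i+a)<\pi(i+b)$ if and only if $\pi'(i+a)<\pi'(i+b)$). The functions $f_0,\ldots,f_{n-k}$ are called the local components of $F$. The Wasserstein distance between two real random variables (or their laws) $X$ and $Z$ is the $L^1$-Wasserstein distance $\sup_h|\mathbb{E}h(X)-\mathbb{E}h(Z)|$, the supremum being over all $1$-Lipschitz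 functions $h:\mathbb{R}\to\mathbb{R}$. Universal means that $C$ does not depend on $n$, $k$, $F$ or $G$. *)

theory Defs
  imports "HOL-Probability.Probability" "HOL-Combinatorics.Permutations"
begin

text \<open>
  The group \<open>S\<^sub>n\<close> of permutations of \<open>{1..n}\<close>. Its elements are functions on all naturals that fix
  every point outside \<open>{1..n}\<close>, so the inverse permutation is \<^const>\<open>inv\<close>.
\<close>

definition sym_group :: "nat \<Rightarrow> (nat \<Rightarrow> nat) set" where
  "sym_group n = {\<pi>. \<pi> permutes {1..n}}"

definition same_relative_order ::
    "nat \<Rightarrow> nat \<Rightarrow> (nat \<Rightarrow> nat) \<Rightarrow> (nat \<Rightarrow> nat) \<Rightarrow> bool" where
  "same_relative_order k i \<pi> \<pi>' \<longleftrightarrow>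
     (\<forall>a\<in>{1..k}. \<forall>b\<in>{1..k}. \<pi> (i + a) < \<pi> (i + b) \<longleftrightarrow> \<pi>' (i + a) < \<pi>' (i + b))"

text \<open>
  \<open>local_statistic n k F f\<close>: the function \<open>F\<close> on \<open>S\<^sub>n\<close> is a local statistic of degree \<open>k\<close>, with local
  components \<open>f 0, \<dots>, f (n - k)\<close>. Values of \<open>F\<close> and \<open>f i\<close> outside \<open>S\<^sub>n\<close> are unconstrained. The
  definition is meant for \<open>k \<le> n\<close> only, since \<open>n - k\<close> is truncated subtraction.
\<close>

definition local_statistic ::
    "nat \<Rightarrow> nat \<Rightarrow> ((nat \<Rightarrow> nat) \<Rightarrow> real) \<Rightarrow> (nat \<Rightarrow> (nat \<Rightarrow> nat) \<Rightarrow> real) \<Rightarrow> bool" where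
  "local_statistic n k F f \<longleftrightarrow>
     (\<forall>\<pi>\<in>sym_group n. F \<pi> = (\<Sum>i=0..n-k. f i \<pi>)) \<and>
     (\<forall>i\<in>{0..n-k}. \<forall>\<pi>\<in>sym_group n. \<forall>\<pi>'\<in>sym_group n.
        same_relative_order k i \<pi> \<pi>' \<longrightarrow> f i \<pi> = f i \<pi>')"

definition uniform_perm :: "nat \<Rightarrow> (nat \<Rightarrow> nat) pmf" where
  "uniform_perm n = pmf_of_set (sym_group n)"

text \<open>
  The \<open>L\<^sup>1\<close>-Wasserstein distance between two laws on the reals with finite first moments (without
  them, the Bochner integrals below may take the default value 0). The supremum is taken in
  \<^typ>\<open>ereal\<close>, where it always exists.
\<close>

definition wasserstein_dist :: "real measure \<Rightarrow> real measure \<Rightarrow> ereal" where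
  "wasserstein_dist M N =
     (SUP h \<in> {h :: real \<Rightarrow> real. 1-lipschitz_on UNIV h}.
        ereal \<bar>(\<integral>x. h x \<partial>M) - (\<integral>x. h x \<partial>N)\<bar>)"

end

(* Stein's method with an exchange argument. After centring, X = sum_p Y_p(pi) + sum_q Z_q(pi^-1).
   A uniform shuffle rho of the positions in the window of Y_p makes pi o rho independent of Y_p(pi),
   and it changes no Y_p' with a disjoint window. It changes Z_q only if two positions of the window
   carry values in the window of Z_q; the expected number of such coincidences over all p and q is
   O(k^4). Hence E[Y_p phi(X)] = E[Y_p (phi(X) - phi(V))] with X - V equal, up to these coincidences,
   to the sum of the Y_p' overlapping Y_p. A Taylor expansion bounds |E[X phi(X) - U phi'(X)]|, where
   U is a sum of locally dependent terms that concentrates around s^2 by a variance estimate; the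
   Z_q are treated in the same way for pi^-1. This gives the bound when k^3 <= n. When k^3 > n it is
   trivial: s^2 <= 32 n k makes n k^3 / s^3 bounded below, and the distance is at most 2. *)
theory Submission
  imports Defs "HOL-Real_Asymp.Real_Asymp"
begin

text \<open>A component of \<open>inv \<pi>\<close> looks at a window of values, whose positions can
  be anywhere, so no fixed dependency graph describes the terms of \<open>X\<close>. Shuffling
  restores exact independence: the relative order of \<pi> on a window is independent of the whole
  shuffled permutation, and each collision costs at most 4.

  \<open>U\<close> contains only products of overlapping components of the same family. Its mean
  misses the covariance between the two families and can differ from \<open>s\<^sup>2\<close>; the
  exchange inequality itself, with the identity as test function, bounds this gap by O(k^4).

  The threshold k^3 <= n is where the collision errors k^4 / s^2 and k^6 / s^3 fall below the
  claimed terms. The constant 3456 is 128 * 9 * (1 + 2): 9 is the Lipschitz constant of the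
  derivative of the Stein solution, and 1 + 2 merges n k^2 and 2 k^6 into n k^3.\<close>

section \<open>Stein's equation for Lipschitz functions\<close>

text \<open>The integrating factor exp (- x^2 / 2) turns Q' <= x * Q into monotonicity, and a
  nonincreasing function with limit 0 at infinity is nonnegative. Decay at infinity thus plays the
  part of an initial value.\<close>

lemma stein_barrier_aux:
  fixes Q :: "real \<Rightarrow> real"
  assumes deriv: "\<And>x. a \<le> x \<Longrightarrow> (Q has_real_derivative x * Q x + d x) (at x)"
    and le: "\<And>x. a \<le> x \<Longrightarrow> d x \<le> 0"
    and lim: "((\<lambda>x. Q x * exp (- x\<^sup>2 / 2)) \<longlongrightarrow> 0) at_top"
  shows "0 \<le> Q a"
proof -
  define R where "R x = Q x * exp (- x\<^sup>2 / 2)" for x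
  have R: "(R has_real_derivative d x * exp (- x\<^sup>2 / 2)) (at x)" if "a \<le> x" for x
    unfolding R_def by (rule derivative_eq_intros deriv[OF that] refl | simp add: algebra_simps)+
  have "R y \<le> R a" if "a \<le> y" for y
    by (rule DERIV_nonpos_imp_nonincreasing[OF that]) (meson R le mult_nonpos_nonneg exp_ge_zero)
  hence "eventually (\<lambda>y. R y \<le> R a) at_top"
    by (auto simp: eventually_at_top_linorder)
  hence "0 \<le> R a"
    using lim tendsto_upperbound[of R 0 at_top "R a"] by (auto simp: R_def[abs_def])
  thus ?thesis by (simp add: R_def zero_le_mult_iff)
qed

text \<open>Comparison principle: \<open>B\<close> is a supersolution for both \<open>r\<close> and
  \<open>- r\<close>, so B - P and B + P both fall under \<open>stein_barrier_aux\<close>. Bounds on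
  the Stein solution then come from a choice of \<open>B\<close>, without Gaussian tail
  estimates.\<close>

lemma stein_barrier:
  fixes P B :: "real \<Rightarrow> real"
  assumes P: "\<And>x. a \<le> x \<Longrightarrow> (P has_real_derivative x * P x + r x) (at x)"
    and B: "\<And>x. a \<le> x \<Longrightarrow> (B has_real_derivative B' x) (at x)"
    and le: "\<And>x. a \<le> x \<Longrightarrow> \<bar>r x\<bar> \<le> x * B x - B' x"
    and limP: "((\<lambda>x. P x * exp (- x\<^sup>2 / 2)) \<longlongrightarrow> 0) at_top"
    and limB: "((\<lambda>x. B x * exp (- x\<^sup>2 / 2)) \<longlongrightarrow> 0) at_top"
  shows "\<bar>P a\<bar> \<le> B a"
proof -
  have "0 \<le> B a - P a"
  proof (rule stein_barrier_aux[where Q = "\<lambda>x. B x - P x" and d = "\<lambda>x. B' x - x * B x - r x"])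
    show "((\<lambda>x. B x - P x) has_real_derivative x * (B x - P x) + (B' x - x * B x - r x)) (at x)"
      if "a \<le> x" for x
      by (rule derivative_eq_intros P[OF that] B[OF that] | simp add: algebra_simps)+
    show "B' x - x * B x - r x \<le> 0" if "a \<le> x" for x
      using le[OF that] by linarith
    show "((\<lambda>x. (B x - P x) * exp (- x\<^sup>2 / 2)) \<longlongrightarrow> 0) at_top"
      using tendsto_diff[OF limB limP] by (simp add: algebra_simps)
  qed
  moreover have "0 \<le> B a + P a"
  proof (rule stein_barrier_aux[where Q = "\<lambda>x. B x + P x" and d = "\<lambda>x. B' x - x * B x + r x"])
    show "((\<lambda>x. B x + P x) has_real_derivative x * (B x + P x) + (B' x - x * B x + r x)) (at x)"
      if "a \<le> x" for x
      by (rule derivative_eq_intros P[OF that] B[OF that] | simp add: algebra_simps)+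
    show "B' x - x * B x + r x \<le> 0" if "a \<le> x" for x
      using le[OF that] by linarith
    show "((\<lambda>x. (B x + P x) * exp (- x\<^sup>2 / 2)) \<longlongrightarrow> 0) at_top"
      using tendsto_add[OF limB limP] by (simp add: algebra_simps)
  qed
  ultimately show ?thesis by linarith
qed

text \<open>
  The second bound concerns the derivative of \<open>x * g x\<close>, so it makes \<open>g'\<close> Lipschitz although \<open>u\<close> need
  not be differentiable.
\<close>

lemma stein_half_line:
  fixes u g :: "real \<Rightarrow> real"
  assumes u: "\<And>x y. \<bar>u x - u y\<bar> \<le> \<bar>x - y\<bar>" and u0: "\<bar>u 0\<bar> \<le> 1"
    and g: "\<And>x. (g has_real_derivative x * g x + u x) (at x)"
    and lim: "((\<lambda>x. g x * exp (- x\<^sup>2 / 2)) \<longlongrightarrow> 0) at_top"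
    and x: "0 \<le> x"
  shows "\<bar>x * g x + u x\<bar> \<le> 5" and "\<bar>g x + x * (x * g x + u x)\<bar> \<le> 8"
proof -
  have u1: "\<bar>u y\<bar> \<le> 1 + y" if "0 \<le> y" for y
    using u[of y 0] u0 that by auto
  have "\<bar>g x\<bar> \<le> 1 + 2 / (1 + x)"
  \<comment> \<open>For large y the summand 1 nearly balances |u y| <= 1 + y, and 2 / (1 + y)
    supplies what is missing; near 0, where y * B y vanishes, it does so through its
    derivative.\<close>
  proof (rule stein_barrier[where P = g and B = "\<lambda>y. 1 + 2 / (1 + y)" and B' = "\<lambda>y. - 2 / (1 + y)\<^sup>2" and r = u])
    fix y assume "x \<le> y"
    with x have y: "0 \<le> y" by simp
    show "((\<lambda>y. 1 + 2 / (1 + y)) has_real_derivative - 2 / (1 + y)\<^sup>2) (at y)"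
      using y by - (rule derivative_eq_intros refl | simp add: power2_eq_square)+
    have "1 \<le> 2 * y / (1 + y) + 2 / (1 + y)\<^sup>2"
    proof -
      have "2 * y / (1 + y) + 2 / (1 + y)\<^sup>2 = (2 * y * (1 + y) + 2) / (1 + y)\<^sup>2"
        using y by (simp add: power2_eq_square add_divide_distrib)
      also have "\<dots> \<ge> 1"
        using y zero_less_power[of "1 + y" 2]
        by (simp add: pos_le_divide_eq) (simp add: power2_eq_square algebra_simps)
      finally show ?thesis .
    qed
    then have "1 + y \<le> y * (1 + 2 / (1 + y)) - - 2 / (1 + y)\<^sup>2"
      by (simp add: algebra_simps)
    with u1[OF y] show "\<bar>u y\<bar> \<le> y * (1 + 2 / (1 + y)) - - 2 / (1 + y)\<^sup>2"
      by linarith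
  next
    show "((\<lambda>x. (1 + 2 / (1 + x)) * exp (- x\<^sup>2 / 2)) \<longlongrightarrow> (0::real)) at_top"
      by real_asymp
  qed (use g lim in auto)
  also have "\<dots> \<le> 3" using x by (simp add: pos_divide_le_eq)
  finally have g3: "\<bar>g x\<bar> \<le> 3" .
  have *: "\<bar>x * g x + u x\<bar> \<le> 5 \<and> \<bar>g x + x * (x * g x + u x)\<bar> \<le> 8"
  proof (cases "x \<le> 1")
    case True
    have "\<bar>x * g x\<bar> \<le> 1 * 3" unfolding abs_mult using True x g3 by (intro mult_mono) auto
    hence 1: "\<bar>x * g x + u x\<bar> \<le> 5" using u1[OF x] True by linarith
    have "\<bar>x * (x * g x + u x)\<bar> \<le> 1 * 5" unfolding abs_mult using True x 1 by (intro mult_mono) auto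
    with 1 g3 show ?thesis by linarith
  next
    case False
    \<comment> \<open>Adding \<open>v / y\<close> with \<open>v\<close> frozen at \<open>x\<close> cancels the leading term of \<open>g\<close> at infinity, and a barrier
      of order \<open>1 / x\<^sup>2\<close> suffices for the rest.\<close>
    define v where "v = u x"
    have v: "\<bar>v\<bar> \<le> 2 * x" using u1[OF x] False by (simp add: v_def)
    \<comment> \<open>The three summands of the barrier pay in turn for its own slope 1 / x, for v /
      y^2 (by |v| <= 2 * x), and for the drift of u y from v, which is at most y - x. The vanishing
      term is kept so that the right-hand side is literally the barrier at x.\<close>
    have "\<bar>g x + v / x\<bar> \<le> (1 / x\<^sup>2 + 2 / x\<^sup>2) + (1 / x) * (x - x)"
    proof (rule stein_barrier[where P = "\<lambda>y. g y + v / y" and B = "\<lambda>y. (1 / x\<^sup>2 + 2 / x\<^sup>2) + (1 / x) * (y - x)" and B' = "\<lambda>y. 1 / x" and r = "\<lambda>y. u y - v - v / y\<^sup>2"])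
      fix y assume y: "x \<le> y"
      with False have y1: "1 < y" by simp
      show "((\<lambda>y. g y + v / y) has_real_derivative y * (g y + v / y) + (u y - v - v / y\<^sup>2)) (at y)"
        using y1 by - ((rule derivative_eq_intros g refl | simp)+, simp add: power2_eq_square field_simps)
      show "((\<lambda>y. (1 / x\<^sup>2 + 2 / x\<^sup>2) + (1 / x) * (y - x)) has_real_derivative 1 / x) (at y)"
        by (rule derivative_eq_intros refl | simp)+
      have "\<bar>v / y\<^sup>2\<bar> \<le> 2 * x / x\<^sup>2"
        unfolding abs_divide using v y False by (intro frac_le) auto
      also have "\<dots> \<le> 2 * y / x\<^sup>2" using y by (intro divide_right_mono) auto
      finally have 1: "\<bar>v / y\<^sup>2\<bar> \<le> 2 * y / x\<^sup>2" .
      have 2: "\<bar>u y - v\<bar> \<le> y - x" using u[of y x] y by (simp add: v_def)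
      have eq1: "2 * y / x\<^sup>2 = 2 * (y / x\<^sup>2)" by simp
      have eq2: "y * ((1 / x\<^sup>2 + 2 / x\<^sup>2) + (1 / x) * (y - x)) = 3 * (y / x\<^sup>2) + y / x * (y - x)"
        by (simp add: algebra_simps)
      have "y - x \<le> y / x * (y - x)" using y False
        using mult_right_mono[of 1 "y / x" "y - x"] by simp
      moreover have "1 / x \<le> y / x\<^sup>2" using y False by (simp add: power2_eq_square divide_simps)
      ultimately have "\<bar>u y - v\<bar> + 2 * y / x\<^sup>2 \<le> y * ((1 / x\<^sup>2 + 2 / x\<^sup>2) + (1 / x) * (y - x)) - 1 / x"
        unfolding eq1 eq2 using 2 by linarith
      with 1 show "\<bar>u y - v - v / y\<^sup>2\<bar> \<le> y * ((1 / x\<^sup>2 + 2 / x\<^sup>2) + (1 / x) * (y - x)) - 1 / x"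
        by linarith
    next
      have "((\<lambda>y. v / y * exp (- y\<^sup>2 / 2)) \<longlongrightarrow> (0::real)) at_top" by real_asymp
      from tendsto_add[OF lim this]
      show "((\<lambda>y. (g y + v / y) * exp (- y\<^sup>2 / 2)) \<longlongrightarrow> 0) at_top" by (simp add: algebra_simps)
      show "((\<lambda>y. ((1 / x\<^sup>2 + 2 / x\<^sup>2) + (1 / x) * (y - x)) * exp (- y\<^sup>2 / 2)) \<longlongrightarrow> (0::real)) at_top"
        by real_asymp
    qed
    hence 1: "\<bar>g x + v / x\<bar> \<le> 3 / x\<^sup>2" by simp
    have "\<bar>x * g x + v\<bar> = x * \<bar>g x + v / x\<bar>"
      using False abs_mult[of x "g x + v / x"] by (simp add: distrib_left)
    also have "\<dots> \<le> x * (3 / x\<^sup>2)" using 1 False by (intro mult_left_mono) auto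
    finally have 2: "\<bar>x * g x + v\<bar> \<le> 3 / x" using False by (simp add: power2_eq_square)
    also have "\<dots> \<le> 3" using False by (simp add: divide_simps)
    finally have 3: "\<bar>x * g x + v\<bar> \<le> 3" .
    have "\<bar>x * (x * g x + v)\<bar> \<le> x * (3 / x)" unfolding abs_mult using 2 False by (intro mult_mono) auto
    hence "\<bar>x * (x * g x + v)\<bar> \<le> 3" using False by simp
    with 3 g3 show ?thesis by (auto simp: v_def)
  qed
  from * show "\<bar>x * g x + u x\<bar> \<le> 5" by (rule conjunct1)
  from * show "\<bar>g x + x * (x * g x + u x)\<bar> \<le> 8" by (rule conjunct2)
qed

text \<open>The inequality |x| <= (1 + x^2) / 2 reduces both claims to the second moment of the
  normal law, which is 1.\<close>

lemma std_normal_lipschitz: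
  fixes h :: "real \<Rightarrow> real"
  assumes h: "1-lipschitz_on UNIV h"
  shows "integrable std_normal_distribution h"
    and "\<bar>h 0 - (\<integral>x. h x \<partial>std_normal_distribution)\<bar> \<le> 1"
proof -
  interpret N: prob_space std_normal_distribution
    using real_dist_normal_dist by (simp add: real_distribution_def)
  have lip: "\<bar>h x - h y\<bar> \<le> \<bar>x - y\<bar>" for x y
    using lipschitz_onD[OF h, of x y] by (simp add: dist_real_def)
  have bound: "\<bar>h 0 - h x\<bar> \<le> (1 + x\<^sup>2) / 2" for x
    using lip[of 0 x] zero_le_power2[of "\<bar>x\<bar> - 1"] by (simp add: power2_diff)
  have cont: "continuous_on UNIV h" by (rule lipschitz_on_continuous_on[OF h])
  then have meas [measurable]: "h \<in> borel_measurable borel"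
    by (rule borel_measurable_continuous_onI)
  have sq: "integrable std_normal_distribution (\<lambda>x. x\<^sup>2)"
    using integrable_std_normal_distribution_moment[of 2] .
  have diff: "integrable std_normal_distribution (\<lambda>x. h 0 - h x)"
  proof (rule Bochner_Integration.integrable_bound)
    show "integrable std_normal_distribution (\<lambda>x. (1 + x\<^sup>2) / 2)" using sq by simp
    show "AE x in std_normal_distribution. norm (h 0 - h x) \<le> norm ((1 + x\<^sup>2) / 2)"
      using bound by (auto intro: order_trans)
  qed simp
  from Bochner_Integration.integrable_diff[OF N.integrable_const[of "h 0"] this]
  show int: "integrable std_normal_distribution h" by simp
  have "h 0 - (\<integral>x. h x \<partial>std_normal_distribution) = (\<integral>x. h 0 - h x \<partial>std_normal_distribution)"
    using int N.prob_space by simp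
  also have "\<bar>\<dots>\<bar> \<le> (\<integral>x. \<bar>h 0 - h x\<bar> \<partial>std_normal_distribution)"
    by (rule integral_abs_bound)
  also have "\<dots> \<le> (\<integral>x. (1 + x\<^sup>2) / 2 \<partial>std_normal_distribution)"
    using diff sq bound by (intro integral_mono) auto
  also have "\<dots> = 1"
    using sq std_normal_distribution_even_moments(1)[of 1] N.prob_space by simp
  finally show "\<bar>h 0 - (\<integral>x. h x \<partial>std_normal_distribution)\<bar> \<le> 1" .
qed

text \<open>The primitive is the integral from minus infinity. Because the total integral vanishes
  it decays at both ends, so that the barrier argument can be run from either infinity.\<close>

lemma lebesgue_primitive:
  fixes f :: "real \<Rightarrow> real"
  assumes f: "integrable lborel f" "continuous_on UNIV f" "(\<integral>x. f x \<partial>lborel) = 0"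
  obtains J where "\<And>x. (J has_real_derivative f x) (at x)" "(J \<longlongrightarrow> 0) at_top" "(J \<longlongrightarrow> 0) at_bot"
proof
  define J where "J w = (\<integral>x. indicator {..w} x *\<^sub>R f x \<partial>lborel)" for w
  have [measurable]: "f \<in> borel_measurable borel"
    using f(2) by (rule borel_measurable_continuous_onI)
  have ind: "integrable lborel (\<lambda>x. indicator A x *\<^sub>R f x)" if "A \<in> sets borel" for A
    using f(1) that by (intro integrable_mult_indicator) auto
  show "(J has_real_derivative f w) (at w)" for w
  proof -
    have eq: "J x = J (w - 1) + integral {w - 1..x} f" if "w - 1 \<le> x" for x
    proof -
      have "integral {w - 1..x} f = (\<integral>t. indicator {w - 1..x} t *\<^sub>R f t \<partial>lborel)"
        using set_borel_integral_eq_integral(2)[of "{w - 1..x}" f] ind[of "{w-1..x}"]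
        by (simp add: set_integrable_def set_lebesgue_integral_def)
      also have "\<dots> = (\<integral>t. indicator {..x} t *\<^sub>R f t - indicator {..w - 1} t *\<^sub>R f t \<partial>lborel)"
      proof (rule integral_cong_AE)
        show "AE t in lborel. indicator {w - 1..x} t *\<^sub>R f t =
            indicator {..x} t *\<^sub>R f t - indicator {..w - 1} t *\<^sub>R f t"
          using AE_lborel_singleton[of "w - 1"] that by (auto simp: indicator_def elim!: eventually_mono)
      qed measurable
      also have "\<dots> = J x - J (w - 1)"
        unfolding J_def using ind by (intro Bochner_Integration.integral_diff) auto
      finally show ?thesis by simp
    qed
    have "((\<lambda>x. J (w - 1) + integral {w - 1..x} f) has_real_derivative f w) (at w within {w - 1..w + 1})"
      using integral_has_real_derivative[of "w - 1" "w + 1" f w] f(2) continuous_on_subset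
      by (auto intro!: derivative_eq_intros)
    then have "(J has_real_derivative f w) (at w within {w - 1..w + 1})"
      by (rule has_field_derivative_transform_within[where d = 1]) (simp_all add: eq[symmetric])
    then show ?thesis by (simp add: at_within_Icc_at)
  qed
  show "(J \<longlongrightarrow> 0) at_top"
    using tendsto_integral_at_top[of lborel f] f by (simp add: J_def[abs_def])
  have "((\<lambda>y. - (\<integral>x. indicator {..y} x *\<^sub>R f (- x) \<partial>lborel)) \<longlongrightarrow> - (\<integral>x. f (- x) \<partial>lborel)) at_top"
    by (intro tendsto_minus tendsto_integral_at_top) (use f lborel_integrable_real_affine[of f "-1" 0] in auto)
  moreover have "(\<integral>x. f (- x) \<partial>lborel) = 0"
    using lborel_integral_real_affine[of "-1" f 0] f(3) by simp
  moreover have "J (- y) = - (\<integral>x. indicator {..y} x *\<^sub>R f (- x) \<partial>lborel)" for y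
  proof -
    have "(\<integral>x. indicator {..y} x *\<^sub>R f (- x) \<partial>lborel) = (\<integral>x. indicator {-y..} x *\<^sub>R f x \<partial>lborel)"
      by (subst (2) lborel_integral_real_affine[of "-1" _ 0])
         (auto intro!: Bochner_Integration.integral_cong simp: indicator_def)
    also have "\<dots> = (\<integral>x. f x - indicator {..-y} x *\<^sub>R f x \<partial>lborel)"
    proof (rule integral_cong_AE)
      show "AE x in lborel. indicator {-y..} x *\<^sub>R f x = f x - indicator {..-y} x *\<^sub>R f x"
        using AE_lborel_singleton[of "- y"] by (auto simp: indicator_def elim!: eventually_mono)
    qed measurable
    also have "\<dots> = - J (- y)"
      unfolding J_def using ind f by (subst Bochner_Integration.integral_diff) auto
    finally show ?thesis by simp
  qed
  ultimately show "(J \<longlongrightarrow> 0) at_bot"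
    by (simp add: at_bot_mirror filterlim_filtermap)
qed

text \<open>This is the classical solution: exp (x^2 / 2) times the Gaussian integral of
  \<open>h\<close> minus its mean. The constant 9 is 8 for x * g x plus 1 for
  \<open>h\<close>.\<close>

lemma stein_solution:
  fixes h :: "real \<Rightarrow> real"
  assumes h: "1-lipschitz_on UNIV h"
  obtains g g' where
    "\<And>x. (g has_real_derivative g' x) (at x)"
    "\<And>x. g' x - x * g x = h x - (\<integral>y. h y \<partial>std_normal_distribution)"
    "\<And>x. \<bar>g' x\<bar> \<le> 5" "\<And>x y. \<bar>g' x - g' y\<bar> \<le> 9 * \<bar>x - y\<bar>"
proof -
  define u where "u x = h x - (\<integral>y. h y \<partial>std_normal_distribution)" for x
  interpret N: prob_space std_normal_distribution
    using real_dist_normal_dist by (simp add: real_distribution_def)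
  note int = std_normal_lipschitz(1)[OF h]
  have cont: "continuous_on UNIV h" by (rule lipschitz_on_continuous_on[OF h])
  then have [measurable]: "h \<in> borel_measurable borel" by (rule borel_measurable_continuous_onI)
  have lip: "\<bar>u x - u y\<bar> \<le> \<bar>x - y\<bar>" for x y
    using lipschitz_onD[OF h, of x y] by (simp add: dist_real_def u_def)
  have u0: "\<bar>u 0\<bar> \<le> 1" using std_normal_lipschitz(2)[OF h] by (simp add: u_def)
  have [measurable]: "u \<in> borel_measurable borel" unfolding u_def by measurable
  have uN: "integrable std_normal_distribution u" "(\<integral>x. u x \<partial>std_normal_distribution) = 0"
    using int N.prob_space by (auto simp: u_def[abs_def])
  have "integrable lborel (\<lambda>x. std_normal_density x * u x)"
    using uN(1) by (subst (asm) integrable_density) (auto simp: normal_density_nonneg)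
  moreover have "(\<integral>x. std_normal_density x * u x \<partial>lborel) = 0"
    using uN(2) by (subst (asm) integral_density) (auto simp: normal_density_nonneg)
  moreover have "continuous_on UNIV (\<lambda>x. std_normal_density x * u x)"
    unfolding std_normal_density_def u_def by (intro continuous_intros cont) auto
  ultimately obtain J where J: "\<And>x. (J has_real_derivative std_normal_density x * u x) (at x)"
      "(J \<longlongrightarrow> 0) at_top" "(J \<longlongrightarrow> 0) at_bot"
    using lebesgue_primitive by blast
  define g where "g x = sqrt (2 * pi) * (exp (x\<^sup>2 / 2) * J x)" for x
  have g: "(g has_real_derivative x * g x + u x) (at x)" for x
  proof -
    have "sqrt (2 * pi) * exp (x\<^sup>2 / 2) * std_normal_density x = 1"
      by (simp add: std_normal_density_def exp_minus)
    from arg_cong[OF this, of "\<lambda>z. z * u x"]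
    have eq: "u x = sqrt (2 * pi) * (exp (x\<^sup>2 / 2) * (std_normal_density x * u x))"
      by (simp add: mult_ac)
    have "(g has_real_derivative sqrt (2 * pi) *
        (exp (x\<^sup>2 / 2) * x * J x + exp (x\<^sup>2 / 2) * (std_normal_density x * u x))) (at x)"
      unfolding g_def by (rule derivative_eq_intros J refl | simp)+
    then show ?thesis by (subst eq) (simp add: g_def algebra_simps)
  qed
  have gJ: "g x * exp (- x\<^sup>2 / 2) = sqrt (2 * pi) * J x" for x
    by (simp add: g_def exp_minus)
  \<comment> \<open>Up to sign, the reflected function solves the equation for the reflected
    \<open>u\<close>, so the negative half-line reduces to the positive one, with the decay of
    \<open>J\<close> at minus infinity.\<close>
  define u2 g2 where "u2 x = u (- x)" and "g2 x = - g (- x)" for x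
  have bounds: "\<bar>x * g x + u x\<bar> \<le> 5 \<and> \<bar>g x + x * (x * g x + u x)\<bar> \<le> 8" for x
  proof (cases "0 \<le> x")
    case True
    have "((\<lambda>x. g x * exp (- x\<^sup>2 / 2)) \<longlongrightarrow> 0) at_top"
      unfolding gJ by (rule tendsto_mult_right_zero[OF J(2)])
    from stein_half_line[OF lip u0 g this True] show ?thesis by simp
  next
    case False
    have lip2: "\<bar>u2 x - u2 y\<bar> \<le> \<bar>x - y\<bar>" for x y using lip[of "-x" "-y"] by (simp add: u2_def)
    have g2: "(g2 has_real_derivative x * g2 x + u2 x) (at x)" for x
      using DERIV_minus[OF DERIV_mirror[THEN iffD1, OF g, of x]] by (simp add: g2_def[abs_def] u2_def)
    have "((\<lambda>x. g2 x * exp (- x\<^sup>2 / 2)) \<longlongrightarrow> 0) at_top"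
    proof -
      have "g2 x * exp (- x\<^sup>2 / 2) = - sqrt (2 * pi) * J (- x)" for x
        using gJ[of "- x"] by (simp add: g2_def)
      moreover have "((\<lambda>x. J (- x)) \<longlongrightarrow> 0) at_top"
        using J(3) by (simp add: at_bot_mirror filterlim_filtermap)
      ultimately show ?thesis by (simp only:) (rule tendsto_mult_right_zero)
    qed
    from stein_half_line[OF lip2 _ g2 this, of "- x"] u0 False
    show ?thesis by (simp add: u2_def g2_def abs_minus_commute)
  qed
  have "\<bar>y * g y - x * g x\<bar> \<le> 8 * \<bar>y - x\<bar>" for x y
  proof -
    have "norm (y * g y - x * g x) \<le> 8 * norm (y - x)"
    proof (rule differentiable_bound[where S = UNIV])
      show "((\<lambda>x. x * g x) has_derivative (\<lambda>z. (g x + x * (x * g x + u x)) * z)) (at x within UNIV)" for x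
        unfolding has_field_derivative_def[symmetric]
        by (rule derivative_eq_intros g refl | simp)+
      show "onorm (\<lambda>z. (g x + x * (x * g x + u x)) * z) \<le> 8" for x
        using bounds[of x] by (intro onorm_le) (auto simp: abs_mult intro!: mult_right_mono)
    qed auto
    then show ?thesis by simp
  qed
  then have "\<bar>(x * g x + u x) - (y * g y + u y)\<bar> \<le> 9 * \<bar>x - y\<bar>" for x y
    using lip[of x y] by (smt (verit))
  with g bounds show ?thesis
    by (intro that[of g "\<lambda>x. x * g x + u x"]) (auto simp: u_def)
qed

section \<open>Averages over permutations\<close>

text \<open>Expectations are kept as finite sums, so that reindexing by a permutation and
  interchanging averages are plain identities; \<open>expectation_uniform_perm\<close> is the
  passage to the measure.\<close>

definition avg :: "'a set \<Rightarrow> ('a \<Rightarrow> real) \<Rightarrow> real" where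
  "avg A X = (\<Sum>x\<in>A. X x) / real (card A)"

lemma avg_add: "avg A (\<lambda>x. X x + Y x) = avg A X + avg A Y"
  by (simp add: avg_def sum.distrib add_divide_distrib)

lemma avg_diff: "avg A (\<lambda>x. X x - Y x) = avg A X - avg A Y"
  by (simp add: avg_def sum_subtractf diff_divide_distrib)

lemma avg_cmult: "avg A (\<lambda>x. c * X x) = c * avg A X"
  by (simp add: avg_def sum_distrib_left)

lemma avg_sum: "avg A (\<lambda>x. \<Sum>i\<in>I. X i x) = (\<Sum>i\<in>I. avg A (X i))"
  unfolding avg_def by (subst sum.swap) (simp add: sum_divide_distrib)

lemma avg_const: "finite A \<Longrightarrow> A \<noteq> {} \<Longrightarrow> avg A (\<lambda>_. c) = c"
  by (simp add: avg_def)

lemma avg_affine: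
  assumes "finite A" "A \<noteq> {}"
  shows "avg A (\<lambda>x. a * (X x + b)) = a * (avg A X + b)"
  by (subst avg_cmult, subst avg_add, subst avg_const[OF assms]) (rule refl)

lemma avg_mono: "(\<And>x. x \<in> A \<Longrightarrow> X x \<le> Y x) \<Longrightarrow> avg A X \<le> avg A Y"
  by (auto simp: avg_def intro!: divide_right_mono sum_mono)

lemma avg_cong: "(\<And>x. x \<in> A \<Longrightarrow> X x = Y x) \<Longrightarrow> avg A X = avg A Y"
  by (simp add: avg_def cong: sum.cong)

lemma avg_abs: "\<bar>avg A X\<bar> \<le> avg A (\<lambda>x. \<bar>X x\<bar>)"
  by (auto simp: avg_def abs_divide intro!: divide_right_mono sum_abs)

lemma avg_abs_le:
  assumes "finite A" "A \<noteq> {}" "\<And>x. x \<in> A \<Longrightarrow> \<bar>X x\<bar> \<le> c"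
  shows "\<bar>avg A X\<bar> \<le> c"
proof -
  have "\<bar>avg A X\<bar> \<le> avg A (\<lambda>x. c)"
    using avg_abs[of A X] avg_mono[of A "\<lambda>x. \<bar>X x\<bar>" "\<lambda>x. c"] assms(3) by force
  with avg_const[OF assms(1,2)] show ?thesis by simp
qed

lemma avg_swap: "avg A (\<lambda>x. avg B (\<lambda>y. X x y)) = avg B (\<lambda>y. avg A (\<lambda>x. X x y))"
  unfolding avg_def sum_divide_distrib[symmetric] by (subst sum.swap) (simp add: mult.commute)

text \<open>Nonnegativity of the variance of |X|.\<close>

lemma avg_abs_le_sqrt:
  assumes "finite A" "A \<noteq> {}"
  shows "avg A (\<lambda>x. \<bar>X x\<bar>) \<le> sqrt (avg A (\<lambda>x. (X x)\<^sup>2))"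
proof (rule real_le_rsqrt)
  define m where "m = avg A (\<lambda>x. \<bar>X x\<bar>)"
  have "0 = avg A (\<lambda>x. 0)" by (simp add: avg_def)
  also have "\<dots> \<le> avg A (\<lambda>x. (\<bar>X x\<bar> - m)\<^sup>2)" by (rule avg_mono) simp
  also have "\<dots> = avg A (\<lambda>x. ((X x)\<^sup>2 - (2 * m) * \<bar>X x\<bar>) + m\<^sup>2)"
    by (rule avg_cong) (simp add: power2_diff algebra_simps)
  also have "\<dots> = avg A (\<lambda>x. (X x)\<^sup>2) - m\<^sup>2"
    by (simp only: avg_add avg_diff avg_cmult avg_const[OF assms] flip: m_def)
       (simp add: power2_eq_square)
  finally show "m\<^sup>2 \<le> avg A (\<lambda>x. (X x)\<^sup>2)" by simp
qed

text \<open>Only pairs at distance less than \<open>L\<close> survive in the expanded square, at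
  most 2 * L for each p. The range \<open>L\<close> will be k for the components and 3 * k for their
  local products.\<close>

lemma avg_square_sum_le:
  fixes a :: "nat \<Rightarrow> 'a \<Rightarrow> real"
  assumes A: "finite A" "A \<noteq> {}" and P: "finite P"
    and bound: "\<And>p x. p \<in> P \<Longrightarrow> x \<in> A \<Longrightarrow> \<bar>a p x\<bar> \<le> c"
    and orth: "\<And>p q. p \<in> P \<Longrightarrow> q \<in> P \<Longrightarrow> p + L \<le> q \<Longrightarrow> avg A (\<lambda>x. a p x * a q x) = 0"
  shows "avg A (\<lambda>x. (\<Sum>p\<in>P. a p x)\<^sup>2) \<le> real (card P) * (2 * real L * c\<^sup>2)"
proof -
  have "avg A (\<lambda>x. (\<Sum>p\<in>P. a p x)\<^sup>2) = (\<Sum>p\<in>P. \<Sum>q\<in>P. avg A (\<lambda>x. a p x * a q x))"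
    by (simp add: power2_eq_square sum_product avg_sum)
  also have "\<dots> \<le> (\<Sum>p\<in>P. 2 * real L * c\<^sup>2)"
  proof (rule sum_mono)
    fix p assume p: "p \<in> P"
    define Q where "Q = {q \<in> P. p < q + L \<and> q < p + L}"
    have "(\<Sum>q\<in>P. avg A (\<lambda>x. a p x * a q x)) = (\<Sum>q\<in>Q. avg A (\<lambda>x. a p x * a q x))"
    proof (rule sum.mono_neutral_right)
      show "\<forall>q\<in>P - Q. avg A (\<lambda>x. a p x * a q x) = 0"
      proof
        fix q assume q: "q \<in> P - Q"
        then consider "p + L \<le> q" | "q + L \<le> p" by (force simp: Q_def)
        then show "avg A (\<lambda>x. a p x * a q x) = 0"
          using orth[of p q] orth[of q p] p q by cases (auto simp: mult.commute)
      qed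
    qed (use P in \<open>auto simp: Q_def\<close>)
    also have "\<dots> \<le> (\<Sum>q\<in>Q. c\<^sup>2)"
    proof (rule sum_mono)
      fix q assume "q \<in> Q"
      then have q: "q \<in> P" by (simp add: Q_def)
      have "\<bar>avg A (\<lambda>x. a p x * a q x)\<bar> \<le> c\<^sup>2"
      proof (rule avg_abs_le[OF A])
        fix x assume x: "x \<in> A"
        have "0 \<le> c" using bound[OF p x] by linarith
        then show "\<bar>a p x * a q x\<bar> \<le> c\<^sup>2"
          unfolding abs_mult power2_eq_square by (intro mult_mono bound p q x) auto
      qed
      then show "avg A (\<lambda>x. a p x * a q x) \<le> c\<^sup>2" by linarith
    qed
    also have "\<dots> = real (card Q) * c\<^sup>2" by simp
    also have "\<dots> \<le> 2 * real L * c\<^sup>2"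
    proof (rule mult_right_mono)
      have "card Q \<le> card {p + 1 - L..<p + L}" by (rule card_mono) (auto simp: Q_def)
      then show "real (card Q) \<le> 2 * real L" by simp
    qed simp
    finally show "(\<Sum>q\<in>P. avg A (\<lambda>x. a p x * a q x)) \<le> 2 * real L * c\<^sup>2" .
  qed
  finally show ?thesis by simp
qed

section \<open>Uniform permutations: invariance, shuffles, independence of relative orders\<close>

abbreviation perms :: "'a set \<Rightarrow> ('a \<Rightarrow> 'a) set" where
  "perms S \<equiv> {\<pi>. \<pi> permutes S}"

lemma perms_nonempty: "perms S \<noteq> {}"
  using permutes_id by blast

lemma avg_perms_compose_right:
  "\<rho> permutes S \<Longrightarrow> avg (perms S) (\<lambda>\<pi>. X (\<pi> \<circ> \<rho>)) = avg (perms S) X"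
  unfolding avg_def using sum_permutations_compose_right[of \<rho> S X] by simp

lemma avg_perms_compose_left:
  "\<rho> permutes S \<Longrightarrow> avg (perms S) (\<lambda>\<pi>. X (\<rho> \<circ> \<pi>)) = avg (perms S) X"
  unfolding avg_def using setum_permutations_compose_left[of \<rho> S X] by simp

lemma avg_perms_inv: "avg (perms S) (\<lambda>\<pi>. X (inv \<pi>)) = avg (perms S) X"
  unfolding avg_def using sum_permutations_inverse[of X S] by simp

text \<open>Send the element of w-rank r to the element of v-rank r. A rank counts smaller entries,
  so injectivity makes both rank maps bijections onto \<open>{..<card I}\<close>.\<close>

lemma exists_rearrangement:
  fixes v w :: "'a \<Rightarrow> 'b :: linorder"
  assumes I: "finite I" and v: "inj_on v I" and w: "inj_on w I"
  obtains \<rho> where "\<rho> permutes I"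
    "\<And>x y. x \<in> I \<Longrightarrow> y \<in> I \<Longrightarrow> v (\<rho> x) < v (\<rho> y) \<longleftrightarrow> w x < w y"
proof
  define r where "r u x = card {z \<in> I. u z < u x}" for u :: "'a \<Rightarrow> 'b" and x
  have less: "r u x < r u y" if "u x < u y" "x \<in> I" for u x y
    unfolding r_def using that I by (intro psubset_card_mono) auto
  have iff: "r u x < r u y \<longleftrightarrow> u x < u y" if "x \<in> I" "y \<in> I" for u x y
    using less[of u x y] less[of u y x] that by (metis less_asym neq_iff r_def)
  have bij: "bij_betw (r u) I {..<card I}" if "inj_on u I" for u
  proof -
    have inj: "inj_on (r u) I"
      using that less by (intro inj_onI) (metis inj_onD less_irrefl neq_iff)
    have "r u ` I \<subseteq> {..<card I}"
      unfolding r_def using I by (auto intro!: psubset_card_mono)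
    moreover have "card (r u ` I) = card {..<card I}" using card_image[OF inj] by simp
    ultimately have "r u ` I = {..<card I}" by (intro card_subset_eq) auto
    with inj show ?thesis by (simp add: bij_betw_def)
  qed
  define \<rho> where "\<rho> x = (if x \<in> I then inv_into I (r v) (r w x) else x)" for x
  have "bij_betw (inv_into I (r v) \<circ> r w) I I"
    using bij_betw_trans[OF bij[OF w] bij_betw_inv_into[OF bij[OF v]]] .
  then have "bij_betw \<rho> I I"
    by (rule bij_betw_cong[THEN iffD1, rotated]) (simp add: \<rho>_def)
  then show perm: "\<rho> permutes I"
    by (rule bij_imp_permutes) (simp add: \<rho>_def)
  have r: "r v (\<rho> x) = r w x" if "x \<in> I" for x
  proof -
    have "r w x \<in> r v ` I" using bij[OF v] bij[OF w] that by (auto simp: bij_betw_def)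
    then show ?thesis using that by (simp add: \<rho>_def f_inv_into_f)
  qed
  show "v (\<rho> x) < v (\<rho> y) \<longleftrightarrow> w x < w y" if "x \<in> I" "y \<in> I" for x y
    using iff[of "\<rho> x" "\<rho> y" v] iff[of x y w] r that permutes_in_image[OF perm] by simp
qed

text \<open>The set \<open>I\<close> is arbitrary rather than a window, because products of
  overlapping components depend on a union of windows.\<close>

definition order_determined ::
    "'a set \<Rightarrow> 'a set \<Rightarrow> (('a :: linorder \<Rightarrow> 'a) \<Rightarrow> real) \<Rightarrow> bool" where
  "order_determined S I Y \<longleftrightarrow> (\<forall>\<pi>\<in>perms S. \<forall>\<pi>'\<in>perms S.
     (\<forall>x\<in>I. \<forall>y\<in>I. \<pi> x < \<pi> y \<longleftrightarrow> \<pi>' x < \<pi>' y) \<longrightarrow> Y \<pi> = Y \<pi>')"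

lemma order_determinedD:
  "order_determined S I Y \<Longrightarrow> \<pi> permutes S \<Longrightarrow> \<pi>' permutes S \<Longrightarrow>
   (\<And>x y. x \<in> I \<Longrightarrow> y \<in> I \<Longrightarrow> \<pi> x < \<pi> y \<longleftrightarrow> \<pi>' x < \<pi>' y) \<Longrightarrow> Y \<pi> = Y \<pi>'"
  unfolding order_determined_def by blast

lemma order_determinedI:
  assumes "\<And>\<pi> \<pi>'. \<pi> permutes S \<Longrightarrow> \<pi>' permutes S \<Longrightarrow>
    (\<And>x y. x \<in> I \<Longrightarrow> y \<in> I \<Longrightarrow> \<pi> x < \<pi> y \<longleftrightarrow> \<pi>' x < \<pi>' y) \<Longrightarrow> Y \<pi> = Y \<pi>'"
  shows "order_determined S I Y"
  unfolding order_determined_def using assms by blast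

lemma order_determined_mono:
  assumes "order_determined S I Y" "I \<subseteq> J"
  shows "order_determined S J Y"
proof (rule order_determinedI)
  fix \<pi> \<pi>' assume "\<pi> permutes S" "\<pi>' permutes S"
    and "\<And>x y. x \<in> J \<Longrightarrow> y \<in> J \<Longrightarrow> \<pi> x < \<pi> y \<longleftrightarrow> \<pi>' x < \<pi>' y"
  then show "Y \<pi> = Y \<pi>'" by (intro order_determinedD[OF assms(1)]) (use assms(2) in blast)+
qed

lemma order_determined_diff_const:
  assumes "order_determined S I Y"
  shows "order_determined S I (\<lambda>\<pi>. Y \<pi> - c)"
  by (rule order_determinedI) (rule arg_cong[where f = "\<lambda>y. y - c"], rule order_determinedD[OF assms])

lemma order_determined_mult:
  assumes "order_determined S I Y" "order_determined S I Z"
  shows "order_determined S I (\<lambda>\<pi>. Y \<pi> * Z \<pi>)"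
  by (rule order_determinedI) (rule arg_cong2[where f = "(*)"]; rule order_determinedD, (rule assms)?, assumption+)

lemma order_determined_sum:
  assumes "\<And>p. p \<in> P \<Longrightarrow> order_determined S I (Y p)"
  shows "order_determined S I (\<lambda>\<pi>. \<Sum>p\<in>P. Y p \<pi>)"
  by (rule order_determinedI) (rule sum.cong[OF refl], rule order_determinedD[OF assms])

lemma order_determined_compose:
  assumes Y: "order_determined S J Y" and \<pi>: "\<pi> permutes S"
    and \<rho>: "\<rho> permutes I" and I: "I \<subseteq> S" "I \<inter> J = {}"
  shows "Y (\<pi> \<circ> \<rho>) = Y \<pi>"
proof (rule order_determinedD[OF Y])
  show "\<pi> \<circ> \<rho> permutes S"
    by (intro permutes_compose permutes_subset[OF \<rho>] I \<pi>)
  fix x y assume "x \<in> J" "y \<in> J"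
  then have "\<rho> x = x" "\<rho> y = y" using I(2) permutes_not_in[OF \<rho>] by blast+
  then show "(\<pi> \<circ> \<rho>) x < (\<pi> \<circ> \<rho>) y \<longleftrightarrow> \<pi> x < \<pi> y" by simp
qed (rule \<pi>)

text \<open>
  Shuffling the entries of a uniform permutation inside \<open>I\<close> makes their relative order independent
  of the result.
\<close>

lemma avg_shuffle_const:
  assumes S: "finite S" "I \<subseteq> S" and Y: "order_determined S I Y" and \<pi>: "\<pi> permutes S"
  shows "avg (perms I) (\<lambda>\<rho>. Y (\<pi> \<circ> \<rho>)) = avg (perms S) Y"
proof -
  note fin = finite_permutations[OF S(1)]
  have I: "finite I" using S by (rule rev_finite_subset)
  have comp: "\<pi> \<circ> \<rho> permutes S" if "\<rho> permutes I" "\<pi> permutes S" for \<pi> \<rho>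
    using that S by (intro permutes_compose permutes_subset[of \<rho> I S])
  have same: "avg (perms I) (\<lambda>\<rho>. Y (\<pi> \<circ> \<rho>)) = avg (perms I) (\<lambda>\<rho>. Y (\<pi>' \<circ> \<rho>))"
    if \<pi>': "\<pi>' permutes S" for \<pi>'
  proof -
    \<comment> \<open>One fixed shuffle \<open>\<rho>0\<close> gives \<pi> the order pattern of
      \<open>\<pi>'\<close> on \<open>I\<close>, and it disappears in the average over all
      shuffles.\<close>
    have "inj_on \<pi> I" "inj_on \<pi>' I" using \<pi> \<pi>' by (auto intro: permutes_inj_on)
    then obtain \<rho>0 where \<rho>0: "\<rho>0 permutes I"
      "\<And>x y. x \<in> I \<Longrightarrow> y \<in> I \<Longrightarrow> \<pi> (\<rho>0 x) < \<pi> (\<rho>0 y) \<longleftrightarrow> \<pi>' x < \<pi>' y"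
      using exists_rearrangement[OF I] by metis
    have "avg (perms I) (\<lambda>\<rho>. Y (\<pi> \<circ> \<rho>)) = avg (perms I) (\<lambda>\<rho>. Y (\<pi> \<circ> (\<rho>0 \<circ> \<rho>)))"
      using avg_perms_compose_left[OF \<rho>0(1), of "\<lambda>\<rho>. Y (\<pi> \<circ> \<rho>)"] by simp
    also have "\<dots> = avg (perms I) (\<lambda>\<rho>. Y (\<pi>' \<circ> \<rho>))"
    proof (rule avg_cong)
      fix \<rho> assume "\<rho> \<in> perms I"
      then have \<rho>: "\<rho> permutes I" by simp
      show "Y (\<pi> \<circ> (\<rho>0 \<circ> \<rho>)) = Y (\<pi>' \<circ> \<rho>)"
      proof (rule order_determinedD[OF Y])
        show "\<pi> \<circ> (\<rho>0 \<circ> \<rho>) permutes S" by (rule comp[OF permutes_compose[OF \<rho> \<rho>0(1)] \<pi>])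
        show "\<pi>' \<circ> \<rho> permutes S" by (rule comp[OF \<rho> \<pi>'])
      qed (simp add: \<rho>0(2) permutes_in_image[OF \<rho>])
    qed
    finally show ?thesis .
  qed
  \<comment> \<open>Being the same for all permutations, the shuffled average equals its own average
    over \<open>\<pi>'\<close>; there right invariance absorbs each shuffle.\<close>
  have "avg (perms I) (\<lambda>\<rho>. Y (\<pi> \<circ> \<rho>)) = avg (perms S) (\<lambda>\<pi>'. avg (perms I) (\<lambda>\<rho>. Y (\<pi> \<circ> \<rho>)))"
    using avg_const[OF fin perms_nonempty] by simp
  also have "\<dots> = avg (perms S) (\<lambda>\<pi>'. avg (perms I) (\<lambda>\<rho>. Y (\<pi>' \<circ> \<rho>)))"
    by (rule avg_cong) (simp add: same)
  also have "\<dots> = avg (perms I) (\<lambda>\<rho>. avg (perms S) (\<lambda>\<pi>'. Y (\<pi>' \<circ> \<rho>)))"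
    by (rule avg_swap)
  also have "\<dots> = avg (perms I) (\<lambda>\<rho>. avg (perms S) Y)"
    using S by (intro avg_cong avg_perms_compose_right) (auto intro: permutes_subset)
  also have "\<dots> = avg (perms S) Y"
    by (rule avg_const[OF finite_permutations[OF I] perms_nonempty])
  finally show ?thesis .
qed

text \<open>The function \<open>b\<close> may use the whole shuffled permutation. Substituting
  \<open>\<pi> \<circ> inv \<rho>\<close> for \<pi> moves the shuffle from \<open>b\<close> to
  \<open>Y\<close>, whose average over shuffles no longer depends on \<pi>.\<close>

lemma avg_mult_shuffle:
  assumes S: "finite S" "I \<subseteq> S" and Y: "order_determined S I Y"
  shows "avg (perms S) (\<lambda>\<pi>. Y \<pi> * avg (perms I) (\<lambda>\<rho>. b (\<pi> \<circ> \<rho>))) =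
    avg (perms S) Y * avg (perms S) b"
proof -
  have "avg (perms S) (\<lambda>\<pi>. Y \<pi> * avg (perms I) (\<lambda>\<rho>. b (\<pi> \<circ> \<rho>))) =
      avg (perms I) (\<lambda>\<rho>. avg (perms S) (\<lambda>\<pi>. Y \<pi> * b (\<pi> \<circ> \<rho>)))"
    by (subst avg_swap) (simp add: avg_cmult)
  also have "\<dots> = avg (perms I) (\<lambda>\<rho>. avg (perms S) (\<lambda>\<pi>. Y (\<pi> \<circ> inv \<rho>) * b \<pi>))"
  proof (rule avg_cong)
    fix \<rho> assume "\<rho> \<in> perms I"
    then have \<rho>: "\<rho> permutes S" using S by (auto intro: permutes_subset)
    have "(\<pi> \<circ> inv \<rho>) \<circ> \<rho> = \<pi>" for \<pi> :: "'a \<Rightarrow> 'a"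
      using permutes_inv_o(2)[OF \<rho>] by (simp add: comp_assoc)
    then show "avg (perms S) (\<lambda>\<pi>. Y \<pi> * b (\<pi> \<circ> \<rho>)) = avg (perms S) (\<lambda>\<pi>. Y (\<pi> \<circ> inv \<rho>) * b \<pi>)"
      using avg_perms_compose_right[OF permutes_inv[OF \<rho>], of "\<lambda>\<pi>. Y \<pi> * b (\<pi> \<circ> \<rho>)"] by simp
  qed
  also have "\<dots> = avg (perms S) (\<lambda>\<pi>. b \<pi> * avg (perms I) (\<lambda>\<rho>. Y (\<pi> \<circ> inv \<rho>)))"
    by (subst avg_swap) (simp add: avg_cmult mult.commute)
  also have "\<dots> = avg (perms S) (\<lambda>\<pi>. avg (perms S) Y * b \<pi>)"
  proof (rule avg_cong)
    fix \<pi> assume "\<pi> \<in> perms S"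
    then have "avg (perms I) (\<lambda>\<rho>. Y (\<pi> \<circ> inv \<rho>)) = avg (perms S) Y"
      using avg_perms_inv[of I "\<lambda>\<rho>. Y (\<pi> \<circ> \<rho>)"] avg_shuffle_const[OF S Y, of \<pi>] by simp
    then show "b \<pi> * avg (perms I) (\<lambda>\<rho>. Y (\<pi> \<circ> inv \<rho>)) = avg (perms S) Y * b \<pi>" by simp
  qed
  finally show ?thesis by (simp add: avg_cmult)
qed

text \<open>\<open>Z\<close> does not notice a shuffle of \<open>I\<close>, so it is its own shuffle
  average and \<open>avg_mult_shuffle\<close> splits the product.\<close>

lemma avg_mult_disjoint:
  assumes S: "finite S" "I \<subseteq> S" and Y: "order_determined S I Y"
    and Z: "order_determined S J Z" and IJ: "I \<inter> J = {}"
  shows "avg (perms S) (\<lambda>\<pi>. Y \<pi> * Z \<pi>) = avg (perms S) Y * avg (perms S) Z"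
proof -
  have "finite I" using S by (rule rev_finite_subset)
  note const = avg_const[OF finite_permutations[OF this] perms_nonempty]
  have "avg (perms S) (\<lambda>\<pi>. Y \<pi> * Z \<pi>) =
      avg (perms S) (\<lambda>\<pi>. Y \<pi> * avg (perms I) (\<lambda>\<rho>. Z (\<pi> \<circ> \<rho>)))"
  proof (rule avg_cong)
    fix \<pi> assume "\<pi> \<in> perms S"
    then have "avg (perms I) (\<lambda>\<rho>. Z (\<pi> \<circ> \<rho>)) = avg (perms I) (\<lambda>\<rho>. Z \<pi>)"
      using order_determined_compose[OF Z _ _ S(2) IJ] by (intro avg_cong) auto
    then show "Y \<pi> * Z \<pi> = Y \<pi> * avg (perms I) (\<lambda>\<rho>. Z (\<pi> \<circ> \<rho>))" by (simp add: const)
  qed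
  then show ?thesis using avg_mult_shuffle[OF S Y] by simp
qed

text \<open>Left multiplication carries any ordered pair of distinct values to any other, so all
  these pairs are equally likely as images of x and y.\<close>

lemma avg_perms_pair:
  assumes S: "finite S" and x: "x \<in> S" "y \<in> S" "x \<noteq> y" and u: "u \<in> S" "v \<in> S" "u \<noteq> v"
  shows "avg (perms S) (\<lambda>\<pi>. of_bool (\<pi> x = u \<and> \<pi> y = v)) =
    1 / (real (card S) * real (card S - 1))"
proof -
  define c where "c w = avg (perms S) (\<lambda>\<pi>. of_bool ((\<pi> x, \<pi> y) = w))" for w
  define D where "D = S \<times> S - (\<lambda>z. (z, z)) ` S"
  have same: "c w = c (u, v)" if "w \<in> D" for w
  proof -
    obtain u' v' where w: "w = (u', v')" "u' \<in> S" "v' \<in> S" "u' \<noteq> v'"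
      using \<open>w \<in> D\<close> by (auto simp: D_def)
    \<comment> \<open>The swap applied first sends u to u' and v to some value other than u'; the
      second brings that value to v' and leaves u' fixed.\<close>
    define t where "t = Transposition.transpose (Transposition.transpose u u' v) v' \<circ> Transposition.transpose u u'"
    have "Transposition.transpose u u' v \<in> S" using u w by (auto simp: Transposition.transpose_def)
    then have t: "t permutes S"
      unfolding t_def using u w by (intro permutes_compose permutes_swap_id)
    have tv: "t u = u'" "t v = v'" using u w by (auto simp: t_def Transposition.transpose_def)
    have "c w = avg (perms S) (\<lambda>\<pi>. of_bool (((t \<circ> \<pi>) x, (t \<circ> \<pi>) y) = w))"
      unfolding c_def by (rule avg_perms_compose_left[OF t, symmetric])
    also have "\<dots> = c (u, v)"
      unfolding c_def w(1) using permutes_inj[OF t] tv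
      by (intro avg_cong) (auto simp: inj_def of_bool_def)
    finally show ?thesis .
  qed
  have finD: "finite D" using S by (simp add: D_def)
  have "1 = avg (perms S) (\<lambda>\<pi>. 1)"
    using avg_const[OF finite_permutations[OF S] perms_nonempty] by simp
  also have "\<dots> = avg (perms S) (\<lambda>\<pi>. \<Sum>w\<in>D. of_bool ((\<pi> x, \<pi> y) = w))"
  proof (rule avg_cong)
    fix \<pi> assume "\<pi> \<in> perms S"
    then have \<pi>: "\<pi> permutes S" by simp
    have "(\<pi> x, \<pi> y) \<in> D"
      using x permutes_in_image[OF \<pi>] permutes_inj[OF \<pi>] by (auto simp: D_def inj_def)
    then show "1 = (\<Sum>w\<in>D. of_bool ((\<pi> x, \<pi> y) = w) :: real)"
      using finD by (simp add: of_bool_def)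
  qed
  also have "\<dots> = (\<Sum>w\<in>D. c w)" by (simp add: avg_sum c_def)
  also have "\<dots> = real (card D) * c (u, v)" using same by simp
  also have "card D = card S * (card S - 1)"
    unfolding D_def using S
    by (subst card_Diff_subset) (auto simp: card_image inj_on_def card_cartesian_product algebra_simps)
  finally have "real (card S) * real (card S - 1) * c (u, v) = 1" by (simp only: of_nat_mult)
  then have "c (u, v) = 1 / (real (card S) * real (card S - 1))"
    by (metis mult_zero_left nonzero_mult_div_cancel_left zero_neq_one)
  then show ?thesis by (simp add: c_def)
qed

section \<open>Local components\<close>

definition window :: "nat \<Rightarrow> nat \<Rightarrow> nat set" where
  "window k p = {p + 1..p + k}"

text \<open>The bound 2 is what a bound of 1 becomes when the mean is subtracted.\<close>

definition centred_components :: "nat \<Rightarrow> nat \<Rightarrow> (nat \<Rightarrow> (nat \<Rightarrow> nat) \<Rightarrow> real) \<Rightarrow> bool" where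
  "centred_components n k Y \<longleftrightarrow> (\<forall>p\<le>n-k.
     order_determined {1..n} (window k p) (Y p) \<and> avg (perms {1..n}) (Y p) = 0 \<and>
     (\<forall>\<pi>\<in>perms {1..n}. \<bar>Y p \<pi>\<bar> \<le> 2))"

text \<open>The range is |p - q| < k, written without truncated subtraction: exactly the overlapping
  windows, including q = p.\<close>

definition neighbour_sum ::
    "nat \<Rightarrow> nat \<Rightarrow> (nat \<Rightarrow> (nat \<Rightarrow> nat) \<Rightarrow> real) \<Rightarrow> nat \<Rightarrow> (nat \<Rightarrow> nat) \<Rightarrow> real" where
  "neighbour_sum n k Y p \<pi> = (\<Sum>q | q \<le> n - k \<and> p < q + k \<and> q < p + k. Y q \<pi>)"

text \<open>For centred components the mean of this quantity is the variance of their sum, since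
  components with disjoint windows are uncorrelated.\<close>

definition local_variance ::
    "nat \<Rightarrow> nat \<Rightarrow> (nat \<Rightarrow> (nat \<Rightarrow> nat) \<Rightarrow> real) \<Rightarrow> (nat \<Rightarrow> nat) \<Rightarrow> real" where
  "local_variance n k Y \<pi> = (\<Sum>p\<le>n-k. Y p \<pi> * neighbour_sum n k Y p \<pi>)"

definition collisions :: "nat \<Rightarrow> nat \<Rightarrow> nat \<Rightarrow> (nat \<Rightarrow> nat) \<Rightarrow> nat" where
  "collisions n k p \<pi> = card {q. q \<le> n - k \<and>
     (\<exists>x\<in>window k p. \<exists>y\<in>window k p. x \<noteq> y \<and> \<pi> x \<in> window k q \<and> \<pi> y \<in> window k q)}"

lemma window_subset: "k \<le> n \<Longrightarrow> p \<le> n - k \<Longrightarrow> window k p \<subseteq> {1..n}"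
  by (auto simp: window_def)

lemma finite_perms: "finite (perms {1..n::nat})"
  by (rule finite_permutations) simp

lemmas avg_perms_const = avg_const[OF finite_perms perms_nonempty]
  and avg_perms_affine = avg_affine[OF finite_perms perms_nonempty]
  and avg_perms_abs_le = avg_abs_le[OF finite_perms perms_nonempty]
  and avg_perms_abs_le_sqrt = avg_abs_le_sqrt[OF finite_perms perms_nonempty]

lemma centred_componentsD:
  assumes "centred_components n k Y" "p \<le> n - k"
  shows "order_determined {1..n} (window k p) (Y p)" "avg (perms {1..n}) (Y p) = 0"
    "\<pi> permutes {1..n} \<Longrightarrow> \<bar>Y p \<pi>\<bar> \<le> 2"
  using assms by (auto simp: centred_components_def)

section \<open>Collisions between windows of positions and windows of values\<close>

lemma collisions_le: "collisions n k p \<pi> \<le> k\<^sup>2"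
proof -
  \<comment> \<open>One of the two colliding values suffices for this crude count: a value v lies in
    the windows of at most k indices, those with v - k <= q < v.\<close>
  have "collisions n k p \<pi> \<le> card (\<Union>x\<in>window k p. {\<pi> x - k..<\<pi> x})"
    unfolding collisions_def by (rule card_mono) (auto simp: window_def)
  also have "\<dots> \<le> (\<Sum>x\<in>window k p. card {\<pi> x - k..<\<pi> x})"
    by (rule card_UN_le) (simp add: window_def)
  also have "\<dots> \<le> (\<Sum>x\<in>window k p. k)" by (rule sum_mono) simp
  also have "\<dots> = k\<^sup>2" by (simp add: window_def power2_eq_square)
  finally show ?thesis .
qed

text \<open>Union bound over at most n windows of values, k (k - 1) ordered pairs of positions and
  as many of values, each event having probability 1 / (n (n - 1)). The factor n anticipates the sum
  over p.\<close>

lemma avg_collisions_le: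
  assumes k: "0 < k" "k \<le> n" and p: "p \<le> n - k"
  shows "real n * avg (perms {1..n}) (\<lambda>\<pi>. real (collisions n k p \<pi>)) \<le> 2 * real k ^ 4"
proof -
  let ?Q = "{..n-k}" and ?O = "\<lambda>q. {(x, y). x \<in> window k q \<and> y \<in> window k q \<and> x \<noteq> y}"
  have O: "finite (?O q)" "card (?O q) = k * (k - 1)" for q
  proof -
    have eq: "?O q = window k q \<times> window k q - (\<lambda>z. (z, z)) ` window k q" by auto
    show "finite (?O q)" unfolding eq by (simp add: window_def)
    show "card (?O q) = k * (k - 1)" unfolding eq
      by (subst card_Diff_subset)
         (auto simp: card_image inj_on_def card_cartesian_product algebra_simps window_def)
  qed
  have le: "real (collisions n k p \<pi>) \<le>
      (\<Sum>q\<in>?Q. \<Sum>(x, y)\<in>?O p. \<Sum>(u, v)\<in>?O q. of_bool (\<pi> x = u \<and> \<pi> y = v))"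
    if \<pi>: "\<pi> permutes {1..n}" for \<pi>
  proof -
    let ?P = "\<lambda>q. \<exists>x\<in>window k p. \<exists>y\<in>window k p. x \<noteq> y \<and> \<pi> x \<in> window k q \<and> \<pi> y \<in> window k q"
    have "real (collisions n k p \<pi>) = (\<Sum>q\<in>?Q. of_bool (?P q))"
    proof -
      have "{q. q \<le> n - k \<and> ?P q} = ?Q \<inter> {q. ?P q}" by auto
      then show ?thesis unfolding collisions_def by (simp add: of_bool_def sum.If_cases)
    qed
    also have "\<dots> \<le> (\<Sum>q\<in>?Q. \<Sum>(x, y)\<in>?O p. \<Sum>(u, v)\<in>?O q. of_bool (\<pi> x = u \<and> \<pi> y = v))"
    proof (rule sum_mono)
      fix q assume "q \<in> ?Q"
      let ?r = "\<Sum>(x, y)\<in>?O p. \<Sum>(u, v)\<in>?O q. of_bool (\<pi> x = u \<and> \<pi> y = v) :: real"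
      show "of_bool (?P q) \<le> ?r"
      proof (cases "?P q")
        case True
        then obtain x y where xy: "(x, y) \<in> ?O p" "\<pi> x \<in> window k q" "\<pi> y \<in> window k q" by auto
        then have uv: "(\<pi> x, \<pi> y) \<in> ?O q" using permutes_inj[OF \<pi>] by (auto simp: inj_def)
        have "(1::real) = (case (\<pi> x, \<pi> y) of (u, v) \<Rightarrow> of_bool (\<pi> x = u \<and> \<pi> y = v))" by simp
        also have "\<dots> \<le> (\<Sum>(u, v)\<in>?O q. of_bool (\<pi> x = u \<and> \<pi> y = v))"
          by (rule member_le_sum[OF uv]) (use O in auto)
        also have "\<dots> = (case (x, y) of (x, y) \<Rightarrow> \<Sum>(u, v)\<in>?O q. of_bool (\<pi> x = u \<and> \<pi> y = v))" by simp
        also have "\<dots> \<le> ?r"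
          by (rule member_le_sum[OF xy(1)]) (use O in \<open>auto intro!: sum_nonneg\<close>)
        finally show ?thesis using True by simp
      next
        case False
        then show ?thesis by (auto intro!: sum_nonneg)
      qed
    qed
    finally show ?thesis .
  qed
  define c where "c = 1 / (real n * real (n - 1))"
  have "avg (perms {1..n}) (\<lambda>\<pi>. real (collisions n k p \<pi>)) \<le>
      avg (perms {1..n}) (\<lambda>\<pi>. \<Sum>q\<in>?Q. \<Sum>w\<in>?O p. \<Sum>z\<in>?O q. of_bool (\<pi> (fst w) = fst z \<and> \<pi> (snd w) = snd z))"
    using le by (intro avg_mono) (simp add: case_prod_beta)
  also have "\<dots> = (\<Sum>q\<in>?Q. \<Sum>w\<in>?O p. \<Sum>z\<in>?O q.
      avg (perms {1..n}) (\<lambda>\<pi>. of_bool (\<pi> (fst w) = fst z \<and> \<pi> (snd w) = snd z)))"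
    by (simp add: avg_sum)
  also have "\<dots> = (\<Sum>q\<in>?Q. \<Sum>w\<in>?O p. \<Sum>z\<in>?O q. c)"
  proof (intro sum.cong refl)
    fix q w z assume "q \<in> ?Q" "w \<in> ?O p" "z \<in> ?O q"
    then have "fst w \<in> {1..n}" "snd w \<in> {1..n}" "fst w \<noteq> snd w"
        "fst z \<in> {1..n}" "snd z \<in> {1..n}" "fst z \<noteq> snd z"
      using window_subset[OF k(2) p] window_subset[OF k(2), of q] by auto
    moreover have "card {1..n} = n" by simp
    ultimately show "avg (perms {1..n}) (\<lambda>\<pi>. of_bool (\<pi> (fst w) = fst z \<and> \<pi> (snd w) = snd z)) = c"
      using avg_perms_pair[of "{1..n}" "fst w" "snd w" "fst z" "snd z"] by (simp only: c_def finite_atLeastAtMost not_False_eq_True)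
  qed
  also have "\<dots> = real (n - k + 1) * (real (k * (k - 1)) * (real (k * (k - 1)) * c))"
    by (simp add: O)
  finally have "real n * avg (perms {1..n}) (\<lambda>\<pi>. real (collisions n k p \<pi>)) \<le>
      real n * (real (n - k + 1) * (real (k * (k - 1)) * (real (k * (k - 1)) * c)))"
    by (intro mult_left_mono) auto
  also have "\<dots> \<le> 2 * real k ^ 4"
  \<comment> \<open>For k = 1 there are no pairs, which also disposes of n = 1, where
    \<open>c\<close> is 1 / 0 = 0. Otherwise n - k + 1 <= n - 1.\<close>
  proof (cases "k = 1")
    case False
    then have k2: "2 \<le> k" "2 \<le> n" using k by auto
    have 1: "real n * c * real (n - k + 1) \<le> 2"
      using k2 k by (simp add: c_def divide_simps)
    have 2: "real (k * (k - 1)) * real (k * (k - 1)) \<le> real (k * k) * real (k * k)"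
      by (intro mult_mono of_nat_mono) auto
    have "(real n * c * real (n - k + 1)) * (real (k * (k - 1)) * real (k * (k - 1)))
        \<le> 2 * (real (k * k) * real (k * k))"
      by (rule mult_mono[OF 1 2]) auto
    then show ?thesis by (simp add: algebra_simps power4_eq_xxxx)
  qed simp
  finally show ?thesis .
qed

text \<open>
  A component \<open>Z q\<close> of the inverse permutation notices a shuffle of the positions in \<open>window k p\<close> only if
  two of these positions carry values in \<open>window k q\<close>.
\<close>

lemma collisions_swap_le:
  assumes k: "0 < k" "k \<le> n" and Z: "centred_components n k Z" and p: "p \<le> n - k"
    and \<pi>: "\<pi> permutes {1..n}" and \<rho>: "\<rho> permutes window k p"
  shows "\<bar>(\<Sum>q\<le>n-k. Z q (inv \<pi>)) - (\<Sum>q\<le>n-k. Z q (inv (\<pi> \<circ> \<rho>)))\<bar> \<le> 4 * real (collisions n k p \<pi>)"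
proof -
  let ?P = "\<lambda>q. \<exists>x\<in>window k p. \<exists>y\<in>window k p. x \<noteq> y \<and> \<pi> x \<in> window k q \<and> \<pi> y \<in> window k q"
  have \<rho>n: "\<rho> permutes {1..n}" using permutes_subset[OF \<rho> window_subset[OF k(2) p]] .
  have \<pi>\<rho>: "\<pi> \<circ> \<rho> permutes {1..n}" by (rule permutes_compose[OF \<rho>n \<pi>])
  have inv: "inv (\<pi> \<circ> \<rho>) = inv \<rho> \<circ> inv \<pi>"
    by (rule o_inv_distrib[OF permutes_bij[OF \<pi>] permutes_bij[OF \<rho>n]])
  have \<rho>i: "inv \<rho> permutes window k p" by (rule permutes_inv[OF \<rho>])
  have eq: "Z q (inv \<pi>) = Z q (inv (\<pi> \<circ> \<rho>))" if q: "q \<le> n - k" "\<not> ?P q" for q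
  proof (rule order_determinedD[OF centred_componentsD(1)[OF Z q(1)]])
    fix u v assume u: "u \<in> window k q" and v: "v \<in> window k q"
    define a b where "a = inv \<pi> u" and "b = inv \<pi> v"
    have ab: "\<pi> a = u" "\<pi> b = v" using permutes_inverses(1)[OF \<pi>] by (auto simp: a_def b_def)
    have a: "inv \<rho> a \<in> window k p \<longleftrightarrow> a \<in> window k p" and b: "inv \<rho> b \<in> window k p \<longleftrightarrow> b \<in> window k p"
      using permutes_in_image[OF \<rho>i] by auto
    have a': "a \<notin> window k p \<Longrightarrow> inv \<rho> a = a" and b': "b \<notin> window k p \<Longrightarrow> inv \<rho> b = b"
      using permutes_not_in[OF \<rho>i] by auto
    \<comment> \<open>Of two distinct points at most one lies in the window. As the window is an
      interval, moving that point inside it preserves its order relative to the other.\<close>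
    have "a = b \<or> a \<notin> window k p \<or> b \<notin> window k p"
      using q(2) ab u v by blast
    then have "a < b \<longleftrightarrow> inv \<rho> a < inv \<rho> b"
      using a b a' b' by (cases "a \<in> window k p"; cases "b \<in> window k p") (auto simp: window_def)
    then show "inv \<pi> u < inv \<pi> v \<longleftrightarrow> inv (\<pi> \<circ> \<rho>) u < inv (\<pi> \<circ> \<rho>) v"
      by (simp add: inv a_def b_def)
  qed (use \<pi> \<pi>\<rho> in \<open>auto intro: permutes_inv\<close>)
  have "\<bar>(\<Sum>q\<le>n-k. Z q (inv \<pi>)) - (\<Sum>q\<le>n-k. Z q (inv (\<pi> \<circ> \<rho>)))\<bar> =
      \<bar>\<Sum>q\<le>n-k. Z q (inv \<pi>) - Z q (inv (\<pi> \<circ> \<rho>))\<bar>"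
    by (simp add: sum_subtractf)
  also have "(\<Sum>q\<le>n-k. Z q (inv \<pi>) - Z q (inv (\<pi> \<circ> \<rho>))) =
      (\<Sum>q | q \<le> n - k \<and> ?P q. Z q (inv \<pi>) - Z q (inv (\<pi> \<circ> \<rho>)))"
    by (rule sum.mono_neutral_right) (auto dest: eq)
  also have "\<bar>\<dots>\<bar> \<le> (\<Sum>q | q \<le> n - k \<and> ?P q. \<bar>Z q (inv \<pi>) - Z q (inv (\<pi> \<circ> \<rho>))\<bar>)"
    by (rule sum_abs)
  also have "\<dots> \<le> (\<Sum>q | q \<le> n - k \<and> ?P q. 4)"
  proof (rule sum_mono)
    fix q assume "q \<in> {q. q \<le> n - k \<and> ?P q}"
    then have "q \<le> n - k" by simp
    from centred_componentsD(3)[OF Z this permutes_inv[OF \<pi>]]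
      centred_componentsD(3)[OF Z this permutes_inv[OF \<pi>\<rho>]]
    show "\<bar>Z q (inv \<pi>) - Z q (inv (\<pi> \<circ> \<rho>))\<bar> \<le> 4" by linarith
  qed
  also have "\<dots> = 4 * real (collisions n k p \<pi>)" by (simp add: collisions_def)
  finally show ?thesis .
qed

section \<open>Neighbour sums and concentration of the local variance\<close>

lemma neighbour_sum_abs_le:
  assumes "centred_components n k Y" "\<pi> permutes {1..n}"
  shows "\<bar>neighbour_sum n k Y p \<pi>\<bar> \<le> 4 * real k"
proof -
  let ?Q = "{q. q \<le> n - k \<and> p < q + k \<and> q < p + k}"
  have "\<bar>neighbour_sum n k Y p \<pi>\<bar> \<le> (\<Sum>q\<in>?Q. \<bar>Y q \<pi>\<bar>)"
    unfolding neighbour_sum_def by (rule sum_abs)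
  also have "\<dots> \<le> (\<Sum>q\<in>?Q. 2)"
    by (rule sum_mono) (use centred_componentsD(3)[OF assms(1)] assms(2) in auto)
  also have "\<dots> = 2 * real (card ?Q)" by simp
  also have "card ?Q \<le> card {p + 1 - k..<p + k}" by (rule card_mono) auto
  then have "2 * real (card ?Q) \<le> 4 * real k" by simp
  finally show ?thesis .
qed

lemma sum_components_square_le:
  assumes k: "0 < k" "k \<le> n" and Y: "centred_components n k Y"
  shows "avg (perms {1..n}) (\<lambda>\<pi>. (\<Sum>p\<le>n-k. Y p \<pi>)\<^sup>2) \<le> 8 * real n * real k"
proof -
  have "avg (perms {1..n}) (\<lambda>\<pi>. (\<Sum>p\<le>n-k. Y p \<pi>)\<^sup>2) \<le> real (card {..n-k}) * (2 * real k * 2\<^sup>2)"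
  proof (rule avg_square_sum_le[OF finite_perms perms_nonempty])
    fix p q assume p: "p \<in> {..n-k}" and q: "q \<in> {..n-k}" and pq: "p + k \<le> q"
    have "window k p \<inter> window k q = {}" using pq by (auto simp: window_def)
    from avg_mult_disjoint[OF _ window_subset[OF k(2)] _ _ this] p q
    show "avg (perms {1..n}) (\<lambda>\<pi>. Y p \<pi> * Y q \<pi>) = 0"
      using centred_componentsD[OF Y] by simp
  qed (use centred_componentsD(3)[OF Y] in auto)
  also have "\<dots> \<le> real n * (2 * real k * 2\<^sup>2)"
    using k by (intro mult_right_mono) auto
  finally show ?thesis by simp
qed

text \<open>Each term of the local variance is determined by fewer than 3 * k consecutive positions,
  collected in \<open>J p\<close>. Terms at distance 3 * k or more are therefore uncorrelated, and
  the variance is of order n k^3.\<close>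

lemma local_variance_deviation_le:
  assumes k: "0 < k" "k \<le> n" and Y: "centred_components n k Y"
  defines "T \<equiv> local_variance n k Y"
  shows "avg (perms {1..n}) (\<lambda>\<pi>. \<bar>T \<pi> - avg (perms {1..n}) T\<bar>) \<le> 40 * sqrt (real n) * real k ^ 2"
proof -
  let ?A = "perms {1..n}"
  define V where "V p \<pi> = Y p \<pi> * neighbour_sum n k Y p \<pi>" for p \<pi>
  define a where "a p \<pi> = V p \<pi> - avg ?A (V p)" for p \<pi>
  define J where "J p = {x. 1 \<le> x \<and> x \<le> n \<and> p < x + k \<and> x < p + 2 * k}" for p
  have V: "\<bar>V p \<pi>\<bar> \<le> 8 * real k" if "p \<le> n - k" "\<pi> permutes {1..n}" for p \<pi>
  proof -
    have "\<bar>V p \<pi>\<bar> \<le> 2 * (4 * real k)"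
      unfolding V_def abs_mult
      using centred_componentsD(3)[OF Y that] neighbour_sum_abs_le[OF Y that(2)]
      by (intro mult_mono) auto
    then show ?thesis by simp
  qed
  have det: "order_determined {1..n} (J p) (a p)" if p: "p \<le> n - k" for p
  proof -
    have "order_determined {1..n} (J p) (Y q)" if "q \<le> n - k" "p < q + k" "q < p + k" for q
      using that k by (intro order_determined_mono[OF centred_componentsD(1)[OF Y that(1)]])
        (auto simp: window_def J_def)
    then have "order_determined {1..n} (J p) (\<lambda>\<pi>. Y p \<pi> * (\<Sum>q | q \<le> n - k \<and> p < q + k \<and> q < p + k. Y q \<pi>))"
      using p k by (intro order_determined_mult order_determined_sum) auto
    then show ?thesis
      unfolding a_def V_def neighbour_sum_def by (rule order_determined_diff_const)
  qed
  have mean: "avg ?A (a p) = 0" for p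
    unfolding a_def by (simp only: avg_diff avg_perms_const diff_self)
  have "avg ?A (\<lambda>\<pi>. (\<Sum>p\<le>n-k. a p \<pi>)\<^sup>2) \<le> real (card {..n-k}) * (2 * real (3 * k) * (16 * real k)\<^sup>2)"
  proof (rule avg_square_sum_le[OF finite_perms perms_nonempty])
    fix p \<pi> assume "p \<in> {..n-k}" and "\<pi> \<in> ?A"
    then have p: "p \<le> n - k" and \<pi>: "\<pi> permutes {1..n}" by auto
    have "\<bar>avg ?A (V p)\<bar> \<le> 8 * real k" using V[OF p] by (intro avg_perms_abs_le) auto
    with V[OF p \<pi>] show "\<bar>a p \<pi>\<bar> \<le> 16 * real k" by (simp add: a_def)
  next
    fix p q assume p: "p \<in> {..n-k}" and q: "q \<in> {..n-k}" and pq: "p + 3 * k \<le> q"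
    have "J p \<inter> J q = {}" "J p \<subseteq> {1..n}" using pq by (auto simp: J_def)
    with avg_mult_disjoint[OF _ _ det det, of p q] p q mean[of p]
    show "avg ?A (\<lambda>\<pi>. a p \<pi> * a q \<pi>) = 0" by simp
  qed simp
  also have "\<dots> \<le> real n * (2 * real (3 * k) * (16 * real k)\<^sup>2)"
    using k by (intro mult_right_mono) auto
  also have "\<dots> = 1536 * real n * real k ^ 3"
    by (simp add: power2_eq_square power3_eq_cube)
  \<comment> \<open>Raising 1536 to 1600 and k^3 to k^4 makes the bound a perfect square; the factor
    k^3 of the final estimate has room for this loss.\<close>
  also have "\<dots> \<le> 1600 * real n * real k ^ 4"
    using k by (intro mult_mono power_increasing) auto
  also have "\<dots> = (40 * sqrt (real n) * real k ^ 2)\<^sup>2"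
    by (simp add: power_mult_distrib)
  finally have sq: "avg ?A (\<lambda>\<pi>. (\<Sum>p\<le>n-k. a p \<pi>)\<^sup>2) \<le> (40 * sqrt (real n) * real k ^ 2)\<^sup>2" .
  have "T \<pi> - avg ?A T = (\<Sum>p\<le>n-k. a p \<pi>)" for \<pi>
    unfolding T_def local_variance_def[abs_def] a_def V_def
    by (simp add: avg_sum sum_subtractf)
  then have "avg ?A (\<lambda>\<pi>. \<bar>T \<pi> - avg ?A T\<bar>) \<le> sqrt (avg ?A (\<lambda>\<pi>. (\<Sum>p\<le>n-k. a p \<pi>)\<^sup>2))"
    using avg_perms_abs_le_sqrt[of n "\<lambda>\<pi>. \<Sum>p\<le>n-k. a p \<pi>"] by simp
  also have "\<dots> \<le> 40 * sqrt (real n) * real k ^ 2"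
    using sq by (intro real_le_lsqrt) auto
  finally show ?thesis .
qed

section \<open>The exchange argument and the Stein discrepancy\<close>

lemma local_exchange:
  assumes k: "0 < k" "k \<le> n"
    and Y: "centred_components n k Y" and Z: "centred_components n k Z"
  defines "X \<equiv> \<lambda>\<pi>. (\<Sum>p\<le>n-k. Y p \<pi>) + (\<Sum>q\<le>n-k. Z q (inv \<pi>))"
  assumes taylor: "\<And>a b. \<bar>\<phi> b - \<phi> a - \<phi>' b * (b - a)\<bar> \<le> M2 * (b - a)\<^sup>2"
    and M1: "\<And>b. \<bar>\<phi>' b\<bar> \<le> M1" and M2: "0 \<le> M2"
  shows "\<bar>avg (perms {1..n}) (\<lambda>\<pi>. (\<Sum>p\<le>n-k. Y p \<pi>) * \<phi> (X \<pi>)) -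
      avg (perms {1..n}) (\<lambda>\<pi>. \<phi>' (X \<pi>) * local_variance n k Y \<pi>)\<bar> \<le>
    16 * M1 * real k ^ 4 + 64 * M2 * (real n * real k ^ 2 + 2 * real k ^ 6)"
proof -
  let ?A = "perms {1..n}" and ?N = "neighbour_sum n k Y" and ?r = "\<lambda>p \<pi>. real (collisions n k p \<pi>)"
  \<comment> \<open>For a uniform shuffle \<open>\<rho>\<close> of the window, \<open>V p (\<pi> \<circ> \<rho>)\<close> is independent of \<open>Y p \<pi>\<close> and close to \<open>X \<pi>\<close>.\<close>
  define V where "V p \<pi> = X \<pi> - ?N p \<pi>" for p \<pi>
  have M1': "0 \<le> M1" using M1[of 0] by linarith
  \<comment> \<open>The increment from the shuffled \<open>V\<close> to \<open>X\<close> is the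
    neighbour sum plus the collision effect \<open>D\<close>. The linear part of \<open>D\<close> is
    charged to \<open>M1\<close> and the square of the increment to \<open>M2\<close>; the
    hypothesis on \<phi> is what a Lipschitz \<open>\<phi>'\<close> provides.\<close>
  have term_le: "\<bar>\<phi> (X \<pi>) - \<phi> (V p (\<pi> \<circ> \<rho>)) - \<phi>' (X \<pi>) * ?N p \<pi>\<bar> \<le>
      (4 * M1 + 32 * M2 * real k ^ 2) * ?r p \<pi> + 32 * M2 * real k ^ 2"
    if p: "p \<le> n - k" and \<pi>: "\<pi> permutes {1..n}" and \<rho>: "\<rho> permutes window k p" for p \<pi> \<rho>
  proof -
    define D where "D = (\<Sum>q\<le>n-k. Z q (inv \<pi>)) - (\<Sum>q\<le>n-k. Z q (inv (\<pi> \<circ> \<rho>)))"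
    let ?v = "V p (\<pi> \<circ> \<rho>)" and ?x = "X \<pi>"
    have D: "\<bar>D\<bar> \<le> 4 * ?r p \<pi>" unfolding D_def by (rule collisions_swap_le[OF k Z p \<pi> \<rho>])
    have far: "(\<Sum>q\<le>n-k. Y q \<tau>) - ?N p \<tau> = (\<Sum>q | q \<le> n - k \<and> \<not> (p < q + k \<and> q < p + k). Y q \<tau>)" for \<tau>
    proof -
      have "{..n-k} = {q. q \<le> n - k \<and> p < q + k \<and> q < p + k} \<union> {q. q \<le> n - k \<and> \<not> (p < q + k \<and> q < p + k)}"
        by auto
      then have "(\<Sum>q\<le>n-k. Y q \<tau>) = ?N p \<tau> + (\<Sum>q | q \<le> n - k \<and> \<not> (p < q + k \<and> q < p + k). Y q \<tau>)"
        unfolding neighbour_sum_def by (simp only:) (rule sum.union_disjoint; auto)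
      then show ?thesis by simp
    qed
    have "Y q (\<pi> \<circ> \<rho>) = Y q \<pi>" if "q \<le> n - k" "\<not> (p < q + k \<and> q < p + k)" for q
      by (rule order_determined_compose[OF centred_componentsD(1)[OF Y that(1)] \<pi> \<rho> window_subset[OF k(2) p]])
         (use that(2) in \<open>auto simp: window_def\<close>)
    then have "(\<Sum>q\<le>n-k. Y q (\<pi> \<circ> \<rho>)) - ?N p (\<pi> \<circ> \<rho>) = (\<Sum>q\<le>n-k. Y q \<pi>) - ?N p \<pi>"
      unfolding far by (intro sum.cong) auto
    then have xv: "?x - ?v = ?N p \<pi> + D"
      by (simp add: X_def V_def D_def)
    have N: "(?N p \<pi>)\<^sup>2 \<le> (4 * real k)\<^sup>2"
      using neighbour_sum_abs_le[OF Y \<pi>, of p] by (intro abs_le_square_iff[THEN iffD1]) auto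
    \<comment> \<open>This linearises the square of the collision count, so that only its mean is
      needed.\<close>
    have r: "?r p \<pi> \<le> real k ^ 2"
      using collisions_le[of n k p \<pi>] of_nat_mono by fastforce
    have "D\<^sup>2 \<le> (4 * ?r p \<pi>)\<^sup>2"
      using D by (intro abs_le_square_iff[THEN iffD1]) auto
    also have "\<dots> = 16 * (?r p \<pi> * ?r p \<pi>)" by (simp add: power2_eq_square)
    also have "\<dots> \<le> 16 * (real k ^ 2 * ?r p \<pi>)"
      using r by (intro mult_left_mono mult_right_mono) auto
    finally have D2: "D\<^sup>2 \<le> 16 * (real k ^ 2 * ?r p \<pi>)" .
    have "(?N p \<pi> + D)\<^sup>2 \<le> 2 * (?N p \<pi>)\<^sup>2 + 2 * D\<^sup>2"
      using zero_le_power2[of "?N p \<pi> - D"] by (simp add: power2_sum power2_diff)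
    also have "\<dots> \<le> 32 * real k ^ 2 + 32 * real k ^ 2 * ?r p \<pi>"
      using N D2 by (simp add: power_mult_distrib)
    finally have sq: "M2 * (?x - ?v)\<^sup>2 \<le> M2 * (32 * real k ^ 2 + 32 * real k ^ 2 * ?r p \<pi>)"
      unfolding xv using M2 by (intro mult_left_mono)
    have "\<bar>\<phi>' ?x * D\<bar> \<le> M1 * (4 * ?r p \<pi>)"
      unfolding abs_mult using M1[of ?x] D M1' by (intro mult_mono) auto
    with taylor[of ?x ?v] sq show ?thesis
      unfolding xv by (simp add: algebra_simps)
  qed
  have window_le: "\<bar>avg ?A (\<lambda>\<pi>. Y p \<pi> * \<phi> (X \<pi>)) - avg ?A (\<lambda>\<pi>. \<phi>' (X \<pi>) * (Y p \<pi> * ?N p \<pi>))\<bar> \<le>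
      (8 * M1 + 64 * M2 * real k ^ 2) * avg ?A (?r p) + 64 * M2 * real k ^ 2"
    (is "\<bar>?D\<bar> \<le> _")
    if p: "p \<le> n - k" for p
  proof -
    let ?B = "perms (window k p)"
    have "finite (window k p)" by (simp add: window_def)
    note B = finite_permutations[OF this] perms_nonempty
    \<comment> \<open>\<open>V p\<close> sees only \<open>\<pi> \<circ> \<rho>\<close>, so the
      average of the product splits, and \<open>Y p\<close> has mean 0.\<close>
    have "avg ?A (\<lambda>\<pi>. Y p \<pi> * avg ?B (\<lambda>\<rho>. \<phi> (V p (\<pi> \<circ> \<rho>)))) = 0"
      using avg_mult_shuffle[OF _ window_subset[OF k(2) p] centred_componentsD(1)[OF Y p], of "\<lambda>\<pi>. \<phi> (V p \<pi>)"]
        centred_componentsD(2)[OF Y p] by simp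
    then have 1: "?D = avg ?A (\<lambda>\<pi>. Y p \<pi> * \<phi> (X \<pi>) - Y p \<pi> * avg ?B (\<lambda>\<rho>. \<phi> (V p (\<pi> \<circ> \<rho>))) - \<phi>' (X \<pi>) * (Y p \<pi> * ?N p \<pi>))"
      by (simp only: avg_diff diff_zero)
    have 2: "?D = avg ?A (\<lambda>\<pi>. Y p \<pi> * avg ?B (\<lambda>\<rho>. \<phi> (X \<pi>) - \<phi> (V p (\<pi> \<circ> \<rho>)) - \<phi>' (X \<pi>) * ?N p \<pi>))"
      unfolding 1 by (rule avg_cong) (simp only: avg_diff avg_const[OF B], simp add: algebra_simps)
    have "\<bar>?D\<bar> \<le> avg ?A (\<lambda>\<pi>. 2 * ((4 * M1 + 32 * M2 * real k ^ 2) * ?r p \<pi> + 32 * M2 * real k ^ 2))"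
      unfolding 2
    proof (rule order_trans[OF avg_abs avg_mono])
      fix \<pi> assume "\<pi> \<in> ?A"
      then have \<pi>: "\<pi> permutes {1..n}" by simp
      have "\<bar>avg ?B (\<lambda>\<rho>. \<phi> (X \<pi>) - \<phi> (V p (\<pi> \<circ> \<rho>)) - \<phi>' (X \<pi>) * ?N p \<pi>)\<bar> \<le>
          (4 * M1 + 32 * M2 * real k ^ 2) * ?r p \<pi> + 32 * M2 * real k ^ 2"
        using term_le[OF p \<pi>] by (intro avg_abs_le[OF B]) auto
      then show "\<bar>Y p \<pi> * avg ?B (\<lambda>\<rho>. \<phi> (X \<pi>) - \<phi> (V p (\<pi> \<circ> \<rho>)) - \<phi>' (X \<pi>) * ?N p \<pi>)\<bar> \<le>
          2 * ((4 * M1 + 32 * M2 * real k ^ 2) * ?r p \<pi> + 32 * M2 * real k ^ 2)"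
        unfolding abs_mult using centred_componentsD(3)[OF Y p \<pi>] by (intro mult_mono) auto
    qed
    also have "\<dots> = 2 * ((4 * M1 + 32 * M2 * real k ^ 2) * avg ?A (?r p) + 32 * M2 * real k ^ 2)"
      by (subst avg_perms_affine, subst avg_cmult) (rule refl)
    finally show ?thesis by (simp add: algebra_simps)
  qed
  have r_le: "avg ?A (?r p) \<le> 2 * real k ^ 4 / real n" if "p \<le> n - k" for p
    using avg_collisions_le[OF k that] k by (simp add: pos_le_divide_eq mult.commute)
  let ?c = "(8 * M1 + 64 * M2 * real k ^ 2) * (2 * real k ^ 4 / real n) + 64 * M2 * real k ^ 2"
  have eq: "avg ?A (\<lambda>\<pi>. (\<Sum>p\<le>n-k. Y p \<pi>) * \<phi> (X \<pi>)) - avg ?A (\<lambda>\<pi>. \<phi>' (X \<pi>) * local_variance n k Y \<pi>) =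
      (\<Sum>p\<le>n-k. avg ?A (\<lambda>\<pi>. Y p \<pi> * \<phi> (X \<pi>)) - avg ?A (\<lambda>\<pi>. \<phi>' (X \<pi>) * (Y p \<pi> * ?N p \<pi>)))"
    unfolding local_variance_def sum_distrib_left sum_distrib_right avg_sum sum_subtractf ..
  have "\<bar>avg ?A (\<lambda>\<pi>. (\<Sum>p\<le>n-k. Y p \<pi>) * \<phi> (X \<pi>)) - avg ?A (\<lambda>\<pi>. \<phi>' (X \<pi>) * local_variance n k Y \<pi>)\<bar> \<le> (\<Sum>p\<le>n-k. ?c)"
    unfolding eq
  proof (rule order_trans[OF sum_abs sum_mono])
    fix p assume "p \<in> {..n-k}"
    then have p: "p \<le> n - k" by simp
    have "(8 * M1 + 64 * M2 * real k ^ 2) * avg ?A (?r p) \<le> (8 * M1 + 64 * M2 * real k ^ 2) * (2 * real k ^ 4 / real n)"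
      using r_le[OF p] M1' M2 by (intro mult_left_mono) auto
    with window_le[OF p]
    show "\<bar>avg ?A (\<lambda>\<pi>. Y p \<pi> * \<phi> (X \<pi>)) - avg ?A (\<lambda>\<pi>. \<phi>' (X \<pi>) * (Y p \<pi> * ?N p \<pi>))\<bar> \<le> ?c"
      by linarith
  qed
  also have "\<dots> = real (n - k + 1) * ?c" by simp
  also have "\<dots> \<le> real n * ?c"
    using k M1' M2 by (intro mult_right_mono add_nonneg_nonneg mult_nonneg_nonneg) auto
  also have "\<dots> = 16 * M1 * real k ^ 4 + 64 * M2 * (real n * real k ^ 2 + 2 * real k ^ 6)"
  proof -
    have "real n * ?c = (8 * M1 + 64 * M2 * real k ^ 2) * (2 * real k ^ 4) + 64 * M2 * (real n * real k ^ 2)"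
      using k by (simp add: distrib_left)
    then show ?thesis by (simp add: algebra_simps eval_nat_numeral)
  qed
  finally show ?thesis .
qed

lemma local_exchange_square:
  assumes k: "0 < k" "k \<le> n"
    and Y: "centred_components n k Y" and Z: "centred_components n k Z"
  defines "X \<equiv> \<lambda>\<pi>. (\<Sum>p\<le>n-k. Y p \<pi>) + (\<Sum>q\<le>n-k. Z q (inv \<pi>))"
    and "U \<equiv> \<lambda>\<pi>. local_variance n k Y \<pi> + local_variance n k Z (inv \<pi>)"
  assumes taylor: "\<And>a b. \<bar>\<phi> b - \<phi> a - \<phi>' b * (b - a)\<bar> \<le> M2 * (b - a)\<^sup>2"
    and M1: "\<And>b. \<bar>\<phi>' b\<bar> \<le> M1" and M2: "0 \<le> M2"
  shows "\<bar>avg (perms {1..n}) (\<lambda>\<pi>. X \<pi> * \<phi> (X \<pi>)) - avg (perms {1..n}) (\<lambda>\<pi>. \<phi>' (X \<pi>) * U \<pi>)\<bar> \<le>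
    32 * M1 * real k ^ 4 + 128 * M2 * (real n * real k ^ 2 + 2 * real k ^ 6)"
proof -
  let ?A = "perms {1..n}" and ?E = "16 * M1 * real k ^ 4 + 64 * M2 * (real n * real k ^ 2 + 2 * real k ^ 6)"
  define X' where "X' \<pi> = (\<Sum>p\<le>n-k. Z p \<pi>) + (\<Sum>q\<le>n-k. Y q (inv \<pi>))" for \<pi>
  have X': "X' (inv \<pi>) = X \<pi>" if "\<pi> \<in> ?A" for \<pi>
    using that permutes_inv_inv[of \<pi>] by (simp add: X'_def X_def)
  have 1: "\<bar>avg ?A (\<lambda>\<pi>. (\<Sum>p\<le>n-k. Y p \<pi>) * \<phi> (X \<pi>)) - avg ?A (\<lambda>\<pi>. \<phi>' (X \<pi>) * local_variance n k Y \<pi>)\<bar> \<le> ?E"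
    unfolding X_def by (rule local_exchange[OF k Y Z taylor M1 M2])
  have "\<bar>avg ?A (\<lambda>\<pi>. (\<Sum>p\<le>n-k. Z p \<pi>) * \<phi> (X' \<pi>)) - avg ?A (\<lambda>\<pi>. \<phi>' (X' \<pi>) * local_variance n k Z \<pi>)\<bar> \<le> ?E"
    unfolding X'_def by (rule local_exchange[OF k Z Y taylor M1 M2])
  moreover have "avg ?A (\<lambda>\<pi>. (\<Sum>p\<le>n-k. Z p \<pi>) * \<phi> (X' \<pi>)) = avg ?A (\<lambda>\<pi>. (\<Sum>p\<le>n-k. Z p (inv \<pi>)) * \<phi> (X \<pi>))"
    by (subst avg_perms_inv[symmetric]) (rule avg_cong, simp only: X')
  moreover have "avg ?A (\<lambda>\<pi>. \<phi>' (X' \<pi>) * local_variance n k Z \<pi>) = avg ?A (\<lambda>\<pi>. \<phi>' (X \<pi>) * local_variance n k Z (inv \<pi>))"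
    by (subst avg_perms_inv[symmetric]) (rule avg_cong, simp only: X')
  moreover have "avg ?A (\<lambda>\<pi>. X \<pi> * \<phi> (X \<pi>)) =
      avg ?A (\<lambda>\<pi>. (\<Sum>p\<le>n-k. Y p \<pi>) * \<phi> (X \<pi>)) + avg ?A (\<lambda>\<pi>. (\<Sum>p\<le>n-k. Z p (inv \<pi>)) * \<phi> (X \<pi>))"
    unfolding avg_add[symmetric] by (rule avg_cong) (simp add: X_def distrib_right)
  moreover have "avg ?A (\<lambda>\<pi>. \<phi>' (X \<pi>) * U \<pi>) =
      avg ?A (\<lambda>\<pi>. \<phi>' (X \<pi>) * local_variance n k Y \<pi>) + avg ?A (\<lambda>\<pi>. \<phi>' (X \<pi>) * local_variance n k Z (inv \<pi>))"
    unfolding avg_add[symmetric] by (rule avg_cong) (simp add: U_def distrib_left)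
  moreover have "2 * ?E = 32 * M1 * real k ^ 4 + 128 * M2 * (real n * real k ^ 2 + 2 * real k ^ 6)"
    by simp
  ultimately show ?thesis using 1 by linarith
qed

lemma stein_discrepancy_le:
  assumes k: "0 < k" "k \<le> n"
    and Y: "centred_components n k Y" and Z: "centred_components n k Z"
  defines "X \<equiv> \<lambda>\<pi>. (\<Sum>p\<le>n-k. Y p \<pi>) + (\<Sum>q\<le>n-k. Z q (inv \<pi>))"
  assumes s: "avg (perms {1..n}) (\<lambda>\<pi>. (X \<pi>)\<^sup>2) = s\<^sup>2"
    and taylor: "\<And>a b. \<bar>\<phi> b - \<phi> a - \<phi>' b * (b - a)\<bar> \<le> M2 * (b - a)\<^sup>2"
    and M1: "\<And>b. \<bar>\<phi>' b\<bar> \<le> M1" and M2: "0 \<le> M2"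
  shows "\<bar>avg (perms {1..n}) (\<lambda>\<pi>. X \<pi> * \<phi> (X \<pi>)) - s\<^sup>2 * avg (perms {1..n}) (\<lambda>\<pi>. \<phi>' (X \<pi>))\<bar> \<le>
    M1 * (64 * real k ^ 4 + 80 * sqrt (real n) * real k ^ 2) + 128 * M2 * (real n * real k ^ 2 + 2 * real k ^ 6)"
proof -
  let ?A = "perms {1..n}"
  define TY TZ where "TY = local_variance n k Y" and "TZ = local_variance n k Z"
  define U where "U \<pi> = TY \<pi> + TZ (inv \<pi>)" for \<pi>
  define m where "m = avg ?A TY + avg ?A TZ"
  have M1': "0 \<le> M1" using M1[of 0] by linarith
  \<comment> \<open>The test function is the identity, with \<open>M1\<close> = 1 and
    \<open>M2\<close> = 0. This compares \<open>s\<^sup>2\<close> with the mean \<open>m\<close> of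
    \<open>U\<close> without computing the covariance of the two families.\<close>
  have "\<bar>avg ?A (\<lambda>\<pi>. X \<pi> * X \<pi>) - avg ?A (\<lambda>\<pi>. 1 * U \<pi>)\<bar> \<le> 32 * 1 * real k ^ 4 + 128 * 0 * (real n * real k ^ 2 + 2 * real k ^ 6)"
    unfolding X_def U_def TY_def TZ_def by (rule local_exchange_square[OF k Y Z]) auto
  moreover have "avg ?A U = m"
    unfolding U_def avg_add avg_perms_inv m_def ..
  ultimately have sm: "\<bar>s\<^sup>2 - m\<bar> \<le> 32 * real k ^ 4"
    using s by (simp add: power2_eq_square)
  have 1: "\<bar>avg ?A (\<lambda>\<pi>. X \<pi> * \<phi> (X \<pi>)) - avg ?A (\<lambda>\<pi>. \<phi>' (X \<pi>) * U \<pi>)\<bar> \<le>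
      32 * M1 * real k ^ 4 + 128 * M2 * (real n * real k ^ 2 + 2 * real k ^ 6)"
    unfolding X_def U_def TY_def TZ_def by (rule local_exchange_square[OF k Y Z taylor M1 M2])
  have "\<bar>avg ?A (\<lambda>\<pi>. \<phi>' (X \<pi>) * U \<pi>) - s\<^sup>2 * avg ?A (\<lambda>\<pi>. \<phi>' (X \<pi>))\<bar> =
      \<bar>avg ?A (\<lambda>\<pi>. \<phi>' (X \<pi>) * (U \<pi> - s\<^sup>2))\<bar>"
    by (simp add: right_diff_distrib avg_diff avg_cmult[symmetric] mult.commute)
  also have "\<dots> \<le> avg ?A (\<lambda>\<pi>. M1 * ((\<bar>TY \<pi> - avg ?A TY\<bar> + \<bar>TZ (inv \<pi>) - avg ?A TZ\<bar>) + 32 * real k ^ 4))"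
  proof (rule order_trans[OF avg_abs avg_mono])
    fix \<pi>
    have "\<bar>U \<pi> - s\<^sup>2\<bar> \<le> (\<bar>TY \<pi> - avg ?A TY\<bar> + \<bar>TZ (inv \<pi>) - avg ?A TZ\<bar>) + 32 * real k ^ 4"
      using sm unfolding U_def m_def by linarith
    then show "\<bar>\<phi>' (X \<pi>) * (U \<pi> - s\<^sup>2)\<bar> \<le> M1 * ((\<bar>TY \<pi> - avg ?A TY\<bar> + \<bar>TZ (inv \<pi>) - avg ?A TZ\<bar>) + 32 * real k ^ 4)"
      unfolding abs_mult using M1 M1' by (intro mult_mono) auto
  qed
  also have "\<dots> = M1 * ((avg ?A (\<lambda>\<pi>. \<bar>TY \<pi> - avg ?A TY\<bar>) + avg ?A (\<lambda>\<pi>. \<bar>TZ \<pi> - avg ?A TZ\<bar>)) + 32 * real k ^ 4)"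
    using avg_perms_inv[of "{1..n}" "\<lambda>\<pi>. \<bar>TZ \<pi> - avg ?A TZ\<bar>"]
    by (subst avg_perms_affine, subst avg_add) (rule arg_cong, simp)
  also have "\<dots> \<le> M1 * ((40 * sqrt (real n) * real k ^ 2 + 40 * sqrt (real n) * real k ^ 2) + 32 * real k ^ 4)"
    unfolding TY_def TZ_def
    by (intro mult_left_mono add_mono local_variance_deviation_le k Y Z M1') auto
  finally have "\<bar>avg ?A (\<lambda>\<pi>. \<phi>' (X \<pi>) * U \<pi>) - s\<^sup>2 * avg ?A (\<lambda>\<pi>. \<phi>' (X \<pi>))\<bar> \<le>
      M1 * (32 * real k ^ 4 + 80 * sqrt (real n) * real k ^ 2)" by (simp add: algebra_simps)
  with 1 have "\<bar>avg ?A (\<lambda>\<pi>. X \<pi> * \<phi> (X \<pi>)) - s\<^sup>2 * avg ?A (\<lambda>\<pi>. \<phi>' (X \<pi>))\<bar> \<le>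
     32 * M1 * real k ^ 4 + 128 * M2 * (real n * real k ^ 2 + 2 * real k ^ 6) +
     M1 * (32 * real k ^ 4 + 80 * sqrt (real n) * real k ^ 2)" by linarith
  then show ?thesis by (simp add: algebra_simps)
qed

section \<open>The two regimes: k^3 at most n, and k^3 above n\<close>

lemma normal_approximation:
  assumes k: "0 < k" "k \<le> n"
    and Y: "centred_components n k Y" and Z: "centred_components n k Z"
  defines "X \<equiv> \<lambda>\<pi>. (\<Sum>p\<le>n-k. Y p \<pi>) + (\<Sum>q\<le>n-k. Z q (inv \<pi>))"
  assumes s: "avg (perms {1..n}) (\<lambda>\<pi>. (X \<pi>)\<^sup>2) = s\<^sup>2" "0 < s"
    and kn: "k ^ 3 \<le> n" and h: "1-lipschitz_on UNIV h"
  shows "\<bar>avg (perms {1..n}) (\<lambda>\<pi>. h (X \<pi> / s)) - (\<integral>x. h x \<partial>std_normal_distribution)\<bar> \<le>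
    3456 * (sqrt (real n) / s ^ 2 + real n / s ^ 3) * real k ^ 3"
proof -
  let ?A = "perms {1..n}" and ?h = "\<integral>x. h x \<partial>std_normal_distribution"
  obtain g g' where g: "\<And>x. (g has_real_derivative g' x) (at x)"
    and stein: "\<And>x. g' x - x * g x = h x - ?h"
    and g'_le: "\<And>x. \<bar>g' x\<bar> \<le> 5" and g'_lip: "\<And>x y. \<bar>g' x - g' y\<bar> \<le> 9 * \<bar>x - y\<bar>"
    using stein_solution[OF h] by blast
  \<comment> \<open>The normalisation goes into the test function: \<open>\<phi>'\<close> is bounded
    by 5 / s and has Lipschitz constant 9 / s^2.\<close>
  define \<phi> \<phi>' where "\<phi> x = g (x / s)" and "\<phi>' x = g' (x / s) / s" for x
  \<comment> \<open>The mean value theorem gives 9 in place of the sharp 9 / 2, and spares an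
    integral remainder.\<close>
  have g_taylor: "\<bar>g b - g a - g' b * (b - a)\<bar> \<le> 9 * (b - a)\<^sup>2" for a b
  proof -
    have "\<bar>g b - g a - g' b * (b - a)\<bar> \<le> 9 * \<bar>b - a\<bar> * \<bar>b - a\<bar>"
    proof (cases "a = b")
      case False
      obtain z where z: "\<bar>b - z\<bar> \<le> \<bar>b - a\<bar>" "g b - g a = (b - a) * g' z"
      proof (cases "a < b")
        case True
        from MVT2[OF this g] that show thesis by force
      next
        case False
        with \<open>a \<noteq> b\<close> have "b < a" by simp
        from MVT2[OF this g] obtain z where "b < z" "z < a" "g a - g b = (a - b) * g' z" by auto
        with that[of z] show thesis by (auto simp: algebra_simps)
      qed
      have "g b - g a - g' b * (b - a) = (g' z - g' b) * (b - a)"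
        unfolding z(2) by (simp add: algebra_simps)
      also have "\<bar>\<dots>\<bar> \<le> 9 * \<bar>b - a\<bar> * \<bar>b - a\<bar>"
        unfolding abs_mult using g'_lip[of z b] z(1) abs_minus_commute[of z b]
        by (intro mult_right_mono) (linarith | simp)+
      finally show ?thesis .
    qed simp
    then show ?thesis by (simp add: power2_eq_square)
  qed
  have taylor: "\<bar>\<phi> b - \<phi> a - \<phi>' b * (b - a)\<bar> \<le> (9 / s\<^sup>2) * (b - a)\<^sup>2" for a b
    using g_taylor[of "b / s" "a / s"]
    by (simp add: \<phi>_def \<phi>'_def power_divide flip: diff_divide_distrib)
  have M1: "\<bar>\<phi>' b\<bar> \<le> 5 / s" for b
    unfolding \<phi>'_def abs_divide using g'_le[of "b / s"] s(2) by (simp add: divide_right_mono)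
  have disc: "\<bar>avg ?A (\<lambda>\<pi>. X \<pi> * \<phi> (X \<pi>)) - s\<^sup>2 * avg ?A (\<lambda>\<pi>. \<phi>' (X \<pi>))\<bar> \<le>
    5 / s * (64 * real k ^ 4 + 80 * sqrt (real n) * real k ^ 2) + 128 * (9 / s\<^sup>2) * (real n * real k ^ 2 + 2 * real k ^ 6)"
    unfolding X_def by (rule stein_discrepancy_le[OF k Y Z _ taylor M1]) (use s in \<open>auto simp: X_def\<close>)
  have "avg ?A (\<lambda>\<pi>. h (X \<pi> / s)) - ?h = avg ?A (\<lambda>\<pi>. h (X \<pi> / s) - ?h)"
    by (simp only: avg_diff avg_perms_const)
  also have "\<dots> = avg ?A (\<lambda>\<pi>. s * \<phi>' (X \<pi>) - (1 / s) * (X \<pi> * \<phi> (X \<pi>)))"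
    using s(2) by (intro avg_cong) (simp add: stein[symmetric] \<phi>_def \<phi>'_def)
  also have "\<dots> = - (avg ?A (\<lambda>\<pi>. X \<pi> * \<phi> (X \<pi>)) - s\<^sup>2 * avg ?A (\<lambda>\<pi>. \<phi>' (X \<pi>))) / s"
    unfolding avg_diff avg_cmult using s(2) by (simp add: field_simps power2_eq_square)
  finally have "\<bar>avg ?A (\<lambda>\<pi>. h (X \<pi> / s)) - ?h\<bar> =
      \<bar>avg ?A (\<lambda>\<pi>. X \<pi> * \<phi> (X \<pi>)) - s\<^sup>2 * avg ?A (\<lambda>\<pi>. \<phi>' (X \<pi>))\<bar> / s"
    using s(2) by (simp only: abs_divide abs_minus_cancel abs_of_pos)
  also have "\<dots> \<le> (5 / s * (64 * real k ^ 4 + 80 * sqrt (real n) * real k ^ 2) +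
      128 * (9 / s\<^sup>2) * (real n * real k ^ 2 + 2 * real k ^ 6)) / s"
    using disc s(2) by (intro divide_right_mono) auto
  also have "\<dots> = (320 * real k ^ 4 + 400 * sqrt (real n) * real k ^ 2) / s ^ 2 +
      (1152 * (real n * real k ^ 2) + 2304 * real k ^ 6) / s ^ 3"
    using s(2) by (simp add: field_simps power2_eq_square power3_eq_cube)
  also have "\<dots> \<le> 3456 * (sqrt (real n) * real k ^ 3) / s ^ 2 + 3456 * (real n * real k ^ 3) / s ^ 3"
  proof -
    \<comment> \<open>The assumption on k acts twice: through k <= sqrt n it absorbs k^4, and
      directly it absorbs k^6. The coefficients add up to 320 + 400 <= 3456 and 1152 + 2304 =
      3456.\<close>
    have kn': "real k ^ 3 \<le> real n" using kn of_nat_mono by fastforce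
    have "real k ^ 2 \<le> real k ^ 3" using k by (intro power_increasing) auto
    with kn' have "real k ^ 2 \<le> real n" by linarith
    then have "real k \<le> sqrt (real n)" by (rule real_le_rsqrt)
    from mult_right_mono[OF this, of "real k ^ 3"]
    have 1: "real k ^ 4 \<le> sqrt (real n) * real k ^ 3" by (simp add: eval_nat_numeral)
    have 2: "sqrt (real n) * real k ^ 2 \<le> sqrt (real n) * real k ^ 3"
      using k by (intro mult_left_mono power_increasing) auto
    have 3: "real n * real k ^ 2 \<le> real n * real k ^ 3"
      using k by (intro mult_left_mono power_increasing) auto
    have 4: "real k ^ 6 \<le> real n * real k ^ 3"
      using mult_right_mono[OF kn', of "real k ^ 3"] by (simp add: eval_nat_numeral)
    have "0 \<le> sqrt (real n) * real k ^ 3" by simp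
    with 1 2 have "320 * real k ^ 4 + 400 * sqrt (real n) * real k ^ 2 \<le> 3456 * (sqrt (real n) * real k ^ 3)"
      by linarith
    moreover have "1152 * (real n * real k ^ 2) + 2304 * real k ^ 6 \<le> 3456 * (real n * real k ^ 3)"
      using 3 4 by linarith
    ultimately show ?thesis using s(2) by (intro add_mono divide_right_mono) auto
  qed
  also have "\<dots> = 3456 * (sqrt (real n) / s ^ 2 + real n / s ^ 3) * real k ^ 3"
    by (simp add: algebra_simps)
  finally show ?thesis .
qed

lemma trivial_approximation:
  assumes k: "0 < k" "k \<le> n"
    and Y: "centred_components n k Y" and Z: "centred_components n k Z"
  defines "X \<equiv> \<lambda>\<pi>. (\<Sum>p\<le>n-k. Y p \<pi>) + (\<Sum>q\<le>n-k. Z q (inv \<pi>))"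
  assumes s: "avg (perms {1..n}) (\<lambda>\<pi>. (X \<pi>)\<^sup>2) = s\<^sup>2" "0 < s"
    and kn: "n < k ^ 3" and h: "1-lipschitz_on UNIV h"
  shows "\<bar>avg (perms {1..n}) (\<lambda>\<pi>. h (X \<pi> / s)) - (\<integral>x. h x \<partial>std_normal_distribution)\<bar> \<le>
    3456 * (sqrt (real n) / s ^ 2 + real n / s ^ 3) * real k ^ 3"
proof -
  let ?A = "perms {1..n}" and ?h = "\<integral>x. h x \<partial>std_normal_distribution"
  have lip: "\<bar>h x - h y\<bar> \<le> \<bar>x - y\<bar>" for x y
    using lipschitz_onD[OF h, of x y] by (simp add: dist_real_def)
  \<comment> \<open>Each law contributes 1 to the distance 2 when compared with h 0: X / s has
    second moment 1, hence first absolute moment at most 1, and the normal law is covered by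
    \<open>std_normal_lipschitz\<close>.\<close>
  have "avg ?A (\<lambda>\<pi>. h (X \<pi> / s)) - h 0 = avg ?A (\<lambda>\<pi>. h (X \<pi> / s) - h 0)"
    by (simp only: avg_diff avg_perms_const)
  then have "\<bar>avg ?A (\<lambda>\<pi>. h (X \<pi> / s)) - h 0\<bar> = \<bar>avg ?A (\<lambda>\<pi>. h (X \<pi> / s) - h 0)\<bar>"
    by (rule arg_cong)
  also have "\<dots> \<le> avg ?A (\<lambda>\<pi>. (1 / s) * \<bar>X \<pi>\<bar>)"
  proof (rule order_trans[OF avg_abs avg_mono])
    show "\<bar>h (X \<pi> / s) - h 0\<bar> \<le> (1 / s) * \<bar>X \<pi>\<bar>" for \<pi>
      using lip[of "X \<pi> / s" 0] s(2) by (simp add: abs_divide)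
  qed
  also have "\<dots> \<le> (1 / s) * sqrt (avg ?A (\<lambda>\<pi>. (X \<pi>)\<^sup>2))"
    unfolding avg_cmult using s(2) by (intro mult_left_mono avg_perms_abs_le_sqrt) auto
  also have "\<dots> = 1" using s by simp
  finally have two: "\<bar>avg ?A (\<lambda>\<pi>. h (X \<pi> / s)) - ?h\<bar> \<le> 2"
    using std_normal_lipschitz(2)[OF h] by linarith
  have "s\<^sup>2 \<le> avg ?A (\<lambda>\<pi>. 2 * (\<Sum>p\<le>n-k. Y p \<pi>)\<^sup>2 + 2 * (\<Sum>q\<le>n-k. Z q (inv \<pi>))\<^sup>2)"
    unfolding s(1)[symmetric] X_def
  proof (rule avg_mono)
    show "(a + b)\<^sup>2 \<le> 2 * a\<^sup>2 + 2 * b\<^sup>2" for a b :: real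
      using zero_le_power2[of "a - b"] by (simp add: power2_sum power2_diff)
  qed
  also have "\<dots> = 2 * avg ?A (\<lambda>\<pi>. (\<Sum>p\<le>n-k. Y p \<pi>)\<^sup>2) + 2 * avg ?A (\<lambda>\<pi>. (\<Sum>p\<le>n-k. Z p \<pi>)\<^sup>2)"
    using avg_perms_inv[of "{1..n}" "\<lambda>\<pi>. (\<Sum>p\<le>n-k. Z p \<pi>)\<^sup>2"] by (simp only: avg_add avg_cmult)
  also have "\<dots> \<le> 32 * (real n * real k)"
    using sum_components_square_le[OF k Y] sum_components_square_le[OF k Z] by linarith
  finally have s2: "s\<^sup>2 \<le> 32 * (real n * real k)" .
  \<comment> \<open>Squares avoid fractional powers. One factor n of (n k)^3 is traded for k^3, and
    182^2 = 33124 exceeds 32^3 = 32768; the later 1728 is half of 3456.\<close>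
  have "(s ^ 3)\<^sup>2 = (s\<^sup>2) ^ 3" by (simp flip: power_mult)
  also have "\<dots> \<le> (32 * (real n * real k)) ^ 3" using s2 by (intro power_mono) auto
  also have "\<dots> = 32768 * (real n ^ 2 * real k ^ 3) * real n"
    by (simp add: power_mult_distrib eval_nat_numeral)
  also have "\<dots> \<le> 32768 * (real n ^ 2 * real k ^ 3) * real k ^ 3"
    using kn by (intro mult_left_mono) (auto simp flip: of_nat_power)
  also have "\<dots> \<le> (182 * (real n * real k ^ 3))\<^sup>2"
    by (simp add: power_mult_distrib eval_nat_numeral)
  finally have "s ^ 3 \<le> 182 * (real n * real k ^ 3)"
    by (rule power2_le_imp_le) simp
  then have "s ^ 3 \<le> 1728 * (real n * real k ^ 3)" by (rule order_trans) simp
  then have "2 \<le> 3456 * (real n / s ^ 3 * real k ^ 3)"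
    using s(2) by (simp add: pos_le_divide_eq)
  also have "\<dots> = 3456 * (0 + real n / s ^ 3) * real k ^ 3" by simp
  also have "\<dots> \<le> 3456 * (sqrt (real n) / s ^ 2 + real n / s ^ 3) * real k ^ 3"
    by (intro mult_right_mono mult_left_mono add_right_mono) auto
  finally show ?thesis using two by linarith
qed

section \<open>Transfer to local statistics and the Wasserstein distance\<close>

lemma sym_group_eq: "sym_group n = perms {1..n}"
  by (simp add: sym_group_def)

lemma expectation_uniform_perm: "measure_pmf.expectation (uniform_perm n) X = avg (perms {1..n}) X"
  unfolding uniform_perm_def sym_group_eq avg_def
  by (rule integral_pmf_of_set[OF perms_nonempty finite_perms])

lemma centred_components_of_local_statistic:
  assumes k: "k \<le> n" and F: "local_statistic n k F f"
    and le: "\<And>i \<pi>. i \<le> n - k \<Longrightarrow> \<pi> permutes {1..n} \<Longrightarrow> \<bar>f i \<pi>\<bar> \<le> 1"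
  shows "centred_components n k (\<lambda>i \<pi>. f i \<pi> - avg (perms {1..n}) (f i))"
  unfolding centred_components_def
proof (intro allI impI conjI ballI)
  fix i assume i: "i \<le> n - k"
  have "order_determined {1..n} (window k i) (f i)"
  proof (rule order_determinedI)
    fix \<pi> \<pi>' assume \<pi>: "\<pi> permutes {1..n}" "\<pi>' permutes {1..n}"
      and eq: "\<And>x y. x \<in> window k i \<Longrightarrow> y \<in> window k i \<Longrightarrow> \<pi> x < \<pi> y \<longleftrightarrow> \<pi>' x < \<pi>' y"
    have "same_relative_order k i \<pi> \<pi>'"
      unfolding same_relative_order_def by (intro ballI eq) (auto simp: window_def)
    then show "f i \<pi> = f i \<pi>'"
      using F i \<pi> unfolding local_statistic_def sym_group_eq by auto
  qed
  then show "order_determined {1..n} (window k i) (\<lambda>\<pi>. f i \<pi> - avg (perms {1..n}) (f i))"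
    by (rule order_determined_diff_const)
  show "avg (perms {1..n}) (\<lambda>\<pi>. f i \<pi> - avg (perms {1..n}) (f i)) = 0"
    by (simp only: avg_diff avg_perms_const diff_self)
  fix \<pi> assume "\<pi> \<in> perms {1..n}"
  then have "\<bar>f i \<pi>\<bar> \<le> 1" using le i by auto
  moreover have "\<bar>avg (perms {1..n}) (f i)\<bar> \<le> 1"
    using le i by (intro avg_perms_abs_le) auto
  ultimately show "\<bar>f i \<pi> - avg (perms {1..n}) (f i)\<bar> \<le> 2" by linarith
qed

text \<open>\<open>F\<close> and \<open>G\<close> are known only on \<open>sym_group n\<close>, so
  \<open>W\<close> is rewritten only under averages over that set. The bound is then proved for each
  \<open>h\<close> separately.\<close>

lemma wasserstein_local_statistics:
  assumes k: "0 < k" "k \<le> n"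
    and F: "local_statistic n k F f" and G: "local_statistic n k G g"
    and le: "\<forall>i\<in>{0..n-k}. \<forall>\<pi>\<in>sym_group n. \<bar>f i \<pi>\<bar> \<le> 1 \<and> \<bar>g i \<pi>\<bar> \<le> 1"
  defines "W \<equiv> \<lambda>\<pi>. F \<pi> + G (inv \<pi>)"
  assumes s: "s\<^sup>2 = measure_pmf.variance (uniform_perm n) W" "0 < s"
  shows "wasserstein_dist
        (distr (measure_pmf (uniform_perm n)) borel
           (\<lambda>\<pi>. (W \<pi> - measure_pmf.expectation (uniform_perm n) W) / s))
        std_normal_distribution
      \<le> ereal (3456 * (sqrt (real n) / s ^ 2 + real n / s ^ 3) * real k ^ 3)"
proof -
  let ?A = "perms {1..n}"
  define Y where "Y i \<pi> = f i \<pi> - avg ?A (f i)" for i \<pi>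
  define Z where "Z i \<pi> = g i \<pi> - avg ?A (g i)" for i \<pi>
  define X where "X \<pi> = (\<Sum>p\<le>n-k. Y p \<pi>) + (\<Sum>q\<le>n-k. Z q (inv \<pi>))" for \<pi>
  have Y: "centred_components n k Y" and Z: "centred_components n k Z"
    using centred_components_of_local_statistic[OF k(2) F] centred_components_of_local_statistic[OF k(2) G] le
    by (simp_all add: Y_def[abs_def] Z_def[abs_def] sym_group_eq)
  have W: "W \<pi> = (\<Sum>p\<le>n-k. f p \<pi>) + (\<Sum>q\<le>n-k. g q (inv \<pi>))" if "\<pi> permutes {1..n}" for \<pi>
    using F G that permutes_inv[OF that]
    by (simp add: W_def local_statistic_def sym_group_eq atMost_atLeast0)
  have "avg ?A W = avg ?A (\<lambda>\<pi>. (\<Sum>p\<le>n-k. f p \<pi>) + (\<Sum>q\<le>n-k. g q (inv \<pi>)))"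
    by (rule avg_cong) (simp add: W)
  also have "\<dots> = (\<Sum>p\<le>n-k. avg ?A (f p)) + (\<Sum>q\<le>n-k. avg ?A (g q))"
    by (simp only: avg_add avg_sum avg_perms_inv)
  finally have X: "W \<pi> - avg ?A W = X \<pi>" if "\<pi> \<in> ?A" for \<pi>
    using W[of \<pi>] that by (simp add: X_def Y_def Z_def sum_subtractf)
  have var: "avg ?A (\<lambda>\<pi>. (X \<pi>)\<^sup>2) = s\<^sup>2"
    unfolding s(1) expectation_uniform_perm by (rule avg_cong) (simp only: X)
  show ?thesis
    unfolding wasserstein_dist_def
  proof (rule SUP_least)
    fix h :: "real \<Rightarrow> real" assume "h \<in> {h. 1-lipschitz_on UNIV h}"
    then have h: "1-lipschitz_on UNIV h" by simp
    then have meas: "h \<in> borel_measurable borel"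
      by (intro borel_measurable_continuous_onI lipschitz_on_continuous_on)
    have "(\<integral>x. h x \<partial>distr (measure_pmf (uniform_perm n)) borel
           (\<lambda>\<pi>. (W \<pi> - measure_pmf.expectation (uniform_perm n) W) / s)) =
        avg ?A (\<lambda>\<pi>. h ((W \<pi> - avg ?A W) / s))"
      using meas by (subst integral_distr) (auto simp: expectation_uniform_perm)
    also have "\<dots> = avg ?A (\<lambda>\<pi>. h (X \<pi> / s))"
      by (rule avg_cong) (simp only: X)
    finally have eq: "(\<integral>x. h x \<partial>distr (measure_pmf (uniform_perm n)) borel
           (\<lambda>\<pi>. (W \<pi> - measure_pmf.expectation (uniform_perm n) W) / s)) =
        avg ?A (\<lambda>\<pi>. h (X \<pi> / s))" .
    have "\<bar>avg ?A (\<lambda>\<pi>. h (X \<pi> / s)) - (\<integral>x. h x \<partial>std_normal_distribution)\<bar> \<le>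
        3456 * (sqrt (real n) / s ^ 2 + real n / s ^ 3) * real k ^ 3"
    proof (cases "k ^ 3 \<le> n")
      case True
      from normal_approximation[OF k Y Z _ s(2) this h] var show ?thesis by (simp add: X_def)
    next
      case False
      then have "n < k ^ 3" by simp
      from trivial_approximation[OF k Y Z _ s(2) this h] var show ?thesis by (simp add: X_def)
    qed
    then show "ereal \<bar>(\<integral>x. h x \<partial>distr (measure_pmf (uniform_perm n)) borel
           (\<lambda>\<pi>. (W \<pi> - measure_pmf.expectation (uniform_perm n) W) / s)) -
        (\<integral>x. h x \<partial>std_normal_distribution)\<bar> \<le>
        ereal (3456 * (sqrt (real n) / s ^ 2 + real n / s ^ 3) * real k ^ 3)"
      unfolding eq by simp
  qed
qed

theorem theorem1p2:
  shows "\<exists>C::real. \<forall>(n::nat) (k::nat)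
      (F :: (nat \<Rightarrow> nat) \<Rightarrow> real) (G :: (nat \<Rightarrow> nat) \<Rightarrow> real)
      (f :: nat \<Rightarrow> (nat \<Rightarrow> nat) \<Rightarrow> real) (g :: nat \<Rightarrow> (nat \<Rightarrow> nat) \<Rightarrow> real)
      (W :: (nat \<Rightarrow> nat) \<Rightarrow> real) (s::real).
      0 < n \<longrightarrow> 0 < k \<longrightarrow> k \<le> n \<longrightarrow>
      local_statistic n k F f \<longrightarrow> local_statistic n k G g \<longrightarrow>
      (\<forall>i\<in>{0..n-k}. \<forall>\<pi>\<in>sym_group n. \<bar>f i \<pi>\<bar> \<le> 1 \<and> \<bar>g i \<pi>\<bar> \<le> 1) \<longrightarrow>
      W = (\<lambda>\<pi>. F \<pi> + G (inv \<pi>)) \<longrightarrow>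
      s\<^sup>2 = measure_pmf.variance (uniform_perm n) W \<longrightarrow> s > 0 \<longrightarrow>
      wasserstein_dist
        (distr (measure_pmf (uniform_perm n)) borel
           (\<lambda>\<pi>. (W \<pi> - measure_pmf.expectation (uniform_perm n) W) / s))
        std_normal_distribution
      \<le> ereal (C * (sqrt (real n) / s ^ 2 + real n / s ^ 3) * real k ^ 3)"
proof (intro exI[of _ 3456] allI impI)
  fix n k :: nat and F G :: "(nat \<Rightarrow> nat) \<Rightarrow> real" and f g :: "nat \<Rightarrow> (nat \<Rightarrow> nat) \<Rightarrow> real"
    and W :: "(nat \<Rightarrow> nat) \<Rightarrow> real" and s :: real
  assume "0 < n" and k: "0 < k" "k \<le> n"
    and FG: "local_statistic n k F f" "local_statistic n k G g"
    and le: "\<forall>i\<in>{0..n-k}. \<forall>\<pi>\<in>sym_group n. \<bar>f i \<pi>\<bar> \<le> 1 \<and> \<bar>g i \<pi>\<bar> \<le> 1"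
    and W: "W = (\<lambda>\<pi>. F \<pi> + G (inv \<pi>))"
    and s: "s\<^sup>2 = measure_pmf.variance (uniform_perm n) W" "0 < s"
  show "wasserstein_dist
        (distr (measure_pmf (uniform_perm n)) borel
           (\<lambda>\<pi>. (W \<pi> - measure_pmf.expectation (uniform_perm n) W) / s))
        std_normal_distribution
      \<le> ereal (3456 * (sqrt (real n) / s ^ 2 + real n / s ^ 3) * real k ^ 3)"
    using wasserstein_local_statistics[OF k FG le s(1)[unfolded W] s(2)] by (simp only: W)
qed

end
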